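(* Let $p,q\in\mathbb C$ with $p\neq0$ and consider the operator $P:\mathcal D'(\mathrm{SU}(2))\to\mathcal D'(\mathrm{SU}(2))$, $Pu:=\partial_0u-qu-p\bar u$. Then $P$ is globally hypoelliptic if and only if $\Delta(\ell)_m:=-m^2+|q|^2-|p|^2-2im\,\mathrm{Re}(q)\neq0$ for all $\ell\in\frac12\mathbb N_0$ and all $m$ with $-\ell\le m\le\ell$, $\ell-m\in\mathbb N_0$.
   Context: $\widehat{\mathrm{SU}(2)}$ consists of the classes of the standard irreducible unitary representations $\mathsf t^\ell:\mathrm{SU}(2)\to\mathbb C^{(2\ell+1)\times(2\ell+1)}$, $\ell\in\frac12\mathbb N_0$ (as in Ruzhansky–Turunen), with matrix entries $\mathsf t^\ell_{mn}$ indexed by $-\ell\le m,n\le\ell$, $\ell-m,\ell-n\in\mathbb N_0$. $\partial_0$ is the neutral left-invariant vector field, whose symbol in these representations is $\sigma_{\partial_0}(\ell)_{mn}=im\delta_{mn}$. For $u\in\mathcal D'$, $\bar u$ is defined by $\langle\bar u,\varphi\rangle=\overline{\langle u,\bar\varphi\rangle}$. $P$ is globally hypoelliptic if $u\in\mathcal D'(\mathrm{SU}(2))$ and $Pu\in C^\infty(\mathrm{SU}(2))$ imply $u\in C^\infty(\mathrm{SU}(2))$. *)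

theory Defs
  imports "HOL-Analysis.Analysis"
begin

type_synonym cmat = "complex ^ 2 ^ 2"

definition adj :: "cmat \<Rightarrow> cmat" where
  "adj U = (\<chi> i j. cnj (U $ j $ i))"

definition SU2 :: "cmat set" where
  "SU2 = {U. adj U ** U = mat 1 \<and> det U = 1}"

primrec Ck :: "nat \<Rightarrow> ('a::real_normed_vector \<Rightarrow> 'b::real_normed_vector) \<Rightarrow> bool" where
  "Ck 0 f = continuous_on UNIV f"
| "Ck (Suc k) f = ((\<forall>x. f differentiable (at x)) \<and>
                    (\<forall>v. Ck k (\<lambda>x. frechet_derivative f (at x) v)))"

definition smooth_amb :: "('a::real_normed_vector \<Rightarrow> 'b::real_normed_vector) \<Rightarrow> bool" where
  "smooth_amb f = (\<forall>k. Ck k f)"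

definition smooth_su2 :: "(cmat \<Rightarrow> complex) \<Rightarrow> bool" where
  "smooth_su2 \<phi> = (\<exists>g. smooth_amb g \<and> (\<forall>x\<in>SU2. g x = \<phi> x))"

text \<open>Basis Z_1, Z_2, Z_3 of su(2), Z_j = (i/2) sigma_j (Pauli matrices), and
  exp(t Z_j) = cos(t/2) I + 2 sin(t/2) Z_j (since Z_j^2 = -I/4).
  Z_3 = diag(i/2, -i/2) generates the maximal torus; it gives the neutral
  field partial_0.\<close>

definition Zb :: "nat \<Rightarrow> cmat" where
  "Zb j = (if j = 1 then (\<chi> a b. if a \<noteq> b then \<i>/2 else 0)
           else if j = 2 then (\<chi> a b. if a = 1 \<and> b = 2 then 1/2
                                    else if a = 2 \<and> b = 1 then -1/2 else 0)
           else (\<chi> a b. if a = b then (if a = 1 then \<i>/2 else -\<i>/2) else 0))"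

definition expZ :: "nat \<Rightarrow> real \<Rightarrow> cmat" where
  "expZ j t = (\<chi> a b. complex_of_real (cos (t/2)) * mat 1 $ a $ b
                 + complex_of_real (2 * sin (t/2)) * Zb j $ a $ b)"

definition lider :: "nat \<Rightarrow> (cmat \<Rightarrow> complex) \<Rightarrow> (cmat \<Rightarrow> complex)" where
  "lider j f x = vector_derivative (\<lambda>t::real. f (x ** expZ j t)) (at 0)"

abbreviation partial0 :: "(cmat \<Rightarrow> complex) \<Rightarrow> (cmat \<Rightarrow> complex)" where
  "partial0 \<equiv> lider 3"

fun liderw :: "nat list \<Rightarrow> (cmat \<Rightarrow> complex) \<Rightarrow> (cmat \<Rightarrow> complex)" where
  "liderw [] f = f"
| "liderw (j # w) f = lider j (liderw w f)"

definition seminorm_k :: "nat \<Rightarrow> (cmat \<Rightarrow> complex) \<Rightarrow> real" where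
  "seminorm_k k \<phi> = (\<Sum>w\<in>{w. length w \<le> k \<and> set w \<subseteq> {1,2,3}}.
                        (SUP x\<in>SU2. cmod (liderw w \<phi> x)))"

definition is_dist :: "((cmat \<Rightarrow> complex) \<Rightarrow> complex) \<Rightarrow> bool" where
  "is_dist u =
     ((\<forall>\<phi> \<psi> a b. smooth_su2 \<phi> \<longrightarrow> smooth_su2 \<psi> \<longrightarrow>
          u (\<lambda>x. a * \<phi> x + b * \<psi> x) = a * u \<phi> + b * u \<psi>) \<and>
      (\<exists>C k. \<forall>\<phi>. smooth_su2 \<phi> \<longrightarrow> cmod (u \<phi>) \<le> C * seminorm_k k \<phi>))"

text \<open>Parametrisation of SU(2) by the unit sphere of C^2, and an integral
  proportional to the (bi-invariant) Haar integral: the rotation invariant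
  measure on S^3 obtained from Lebesgue measure on C^2 with Gaussian radial
  weight.\<close>

definition su2_of :: "complex \<times> complex \<Rightarrow> cmat" where
  "su2_of z = (\<chi> i j. if i = 1 \<and> j = 1 then fst z
                     else if i = 1 \<and> j = 2 then - cnj (snd z)
                     else if i = 2 \<and> j = 1 then snd z
                     else cnj (fst z))"

definition haar_int :: "(cmat \<Rightarrow> complex) \<Rightarrow> complex" where
  "haar_int g = (LINT z|lborel. g (su2_of ((1 / norm z) *\<^sub>R z)) * complex_of_real (exp (- (norm z)\<^sup>2)))"

definition smooth_dist :: "((cmat \<Rightarrow> complex) \<Rightarrow> complex) \<Rightarrow> bool" where
  "smooth_dist u = (\<exists>f. smooth_su2 f \<and>
       (\<forall>\<phi>. smooth_su2 \<phi> \<longrightarrow> u \<phi> = haar_int (\<lambda>x. f x * \<phi> x)))"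

definition dpartial0 :: "((cmat \<Rightarrow> complex) \<Rightarrow> complex) \<Rightarrow> ((cmat \<Rightarrow> complex) \<Rightarrow> complex)" where
  "dpartial0 u \<phi> = - u (partial0 \<phi>)"

definition dconj :: "((cmat \<Rightarrow> complex) \<Rightarrow> complex) \<Rightarrow> ((cmat \<Rightarrow> complex) \<Rightarrow> complex)" where
  "dconj u \<phi> = cnj (u (\<lambda>x. cnj (\<phi> x)))"

definition Pop :: "complex \<Rightarrow> complex \<Rightarrow> ((cmat \<Rightarrow> complex) \<Rightarrow> complex) \<Rightarrow> ((cmat \<Rightarrow> complex) \<Rightarrow> complex)" where
  "Pop p q u \<phi> = dpartial0 u \<phi> - q * u \<phi> - p * dconj u \<phi>"

definition globally_hypoelliptic ::
  "(((cmat \<Rightarrow> complex) \<Rightarrow> complex) \<Rightarrow> ((cmat \<Rightarrow> complex) \<Rightarrow> complex)) \<Rightarrow> bool" where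
  "globally_hypoelliptic P = (\<forall>u. is_dist u \<longrightarrow> smooth_dist (P u) \<longrightarrow> smooth_dist u)"

end

theory Submission
  imports Defs "HOL-Probability.Distributions"
begin

text \<open>
  Write \<open>D\<close> for the derivative along the flow \<open>x \<mapsto> x exp(t Z\<^sub>3)\<close>, whose orbits are circles of period
  \<open>4\<pi>\<close>. Eliminating the conjugate of \<open>u\<close> between \<open>P u = f\<close> and its conjugate equation gives
  \<open>(D\<^sup>2 - 2 Re(q) D + |q|\<^sup>2 - |p|\<^sup>2) u = g\<close> with \<open>g\<close> smooth. The operator on the left factors as
  \<open>(D - z\<^sub>1)(D - z\<^sub>2)\<close>, and the condition on \<open>\<Delta>\<close> says exactly that \<open>exp(4 \<pi> z\<^sub>j) \<noteq> 1\<close>, i.e. that each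
  factor is inverted on smooth functions by an explicit integral over the period. Together with the
  invariance of the Haar integral this shows that \<open>u\<close> is smooth.

  Conversely, if \<open>\<Delta>\<close> vanishes at \<open>m\<close>, the equation \<open>w' = q w + p cnj w\<close> has a nonzero \<open>4\<pi>\<close>-periodic
  solution spanned by \<open>e\<^bsup>\<plusminus>imt\<^esup>\<close>; the measure on the maximal torus with density \<open>w\<close> is then annihilated
  by \<open>P\<close> and is not smooth.
\<close>

section \<open>Smooth functions\<close>

text \<open>Frechet derivatives are unique, so any exhibited derivative can stand in for
  \<open>frechet_derivative\<close> in the recursion of \<open>Ck\<close>.\<close>

lemma Ck_SucI:
  assumes "\<And>x. (f has_derivative f' x) (at x)" "\<And>v. Ck k (\<lambda>x. f' x v)"
  shows "Ck (Suc k) f"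
proof -
  have "frechet_derivative f (at x) = f' x" for x
    using assms(1)[of x] frechet_derivative_at by metis
  then show ?thesis
    using assms by (auto simp: differentiable_def)
qed

lemma Ck_SucE:
  assumes "Ck (Suc k) f"
  obtains f' where "\<And>x. (f has_derivative f' x) (at x)" "\<And>v. Ck k (\<lambda>x. f' x v)"
  using assms by (metis Ck.simps(2) frechet_derivative_works)

lemma Ck_Suc_imp_continuous_on:
  assumes "Ck (Suc k) f"
  shows "continuous_on S f"
  using assms by (simp add: continuous_at_imp_continuous_on differentiable_imp_continuous_within)

lemma Ck_imp_continuous_on:
  assumes "Ck k f"
  shows "continuous_on S f"
  using assms Ck_Suc_imp_continuous_on
  by (cases k) (auto intro: continuous_on_subset)

lemma Ck_SucD: "Ck (Suc k) f \<Longrightarrow> Ck k f"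
proof (induction k arbitrary: f)
  case 0
  then show ?case using Ck_Suc_imp_continuous_on[of 0 f UNIV] by simp
next
  case (Suc k)
  then show ?case by (metis Ck.simps(2))
qed

lemma Ck_const: "Ck k (\<lambda>x. c)"
  by (induction k arbitrary: c) (auto intro!: Ck_SucI[where f'="\<lambda>x v. 0"])

lemma Ck_bounded_linear: "bounded_linear f \<Longrightarrow> Ck k f"
  by (cases k)
     (auto simp del: Ck.simps(2) intro!: Ck_SucI[where f'="\<lambda>x. f"] Ck_const
       intro: bounded_linear_imp_has_derivative linear_continuous_on)

lemma Ck_add:
  assumes "Ck k f" "Ck k g"
  shows "Ck k (\<lambda>x. f x + g x)"
  using assms
proof (induction k arbitrary: f g)
  case 0
  then show ?case by (auto intro: continuous_intros)
next
  case (Suc k)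
  obtain f' g' where f': "\<And>x. (f has_derivative f' x) (at x)" "\<And>v. Ck k (\<lambda>x. f' x v)"
    and g': "\<And>x. (g has_derivative g' x) (at x)" "\<And>v. Ck k (\<lambda>x. g' x v)"
    using Suc.prems by (metis Ck_SucE)
  show ?case
    by (rule Ck_SucI[where f'="\<lambda>x v. f' x v + g' x v"])
       (auto intro!: f' g' Suc.IH derivative_eq_intros)
qed

text \<open>Each term of the product rule is again \<open>B\<close> applied to two functions of
  class \<open>k\<close>, one of them a derivative; hence the induction runs over all pairs
  \<open>f\<close>, \<open>g\<close>.\<close>

lemma Ck_bounded_bilinear:
  assumes "bounded_bilinear B" "Ck k f" "Ck k g"
  shows "Ck k (\<lambda>x. B (f x) (g x))"
  using assms(2,3)
proof (induction k arbitrary: f g)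
  case 0
  then show ?case by (auto intro: bounded_bilinear.continuous_on[OF assms(1)])
next
  case (Suc k)
  obtain f' g' where f': "\<And>x. (f has_derivative f' x) (at x)" "\<And>v. Ck k (\<lambda>x. f' x v)"
    and g': "\<And>x. (g has_derivative g' x) (at x)" "\<And>v. Ck k (\<lambda>x. g' x v)"
    using Suc.prems by (metis Ck_SucE)
  show ?case
    by (rule Ck_SucI[where f'="\<lambda>x v. B (f x) (g' x v) + B (f' x v) (g x)"])
       (auto intro!: f' g' Suc.IH Ck_add Suc.prems[THEN Ck_SucD]
          bounded_bilinear.FDERIV[OF assms(1)] simp del: Ck.simps)
qed

lemma Ck_bounded_linear_compose:
  assumes "bounded_linear L" "Ck k f"
  shows "Ck k (\<lambda>x. L (f x))"
  using assms(2)
proof (induction k arbitrary: f)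
  case 0
  then show ?case by (auto intro: bounded_linear.continuous_on[OF assms(1)])
next
  case (Suc k)
  obtain f' where f': "\<And>x. (f has_derivative f' x) (at x)" "\<And>v. Ck k (\<lambda>x. f' x v)"
    using Suc.prems by (metis Ck_SucE)
  show ?case
    by (rule Ck_SucI[where f'="\<lambda>x v. L (f' x v)"])
       (auto intro!: f' Suc.IH bounded_linear.has_derivative[OF assms(1)])
qed

lemma Ck_sum:
  assumes "\<And>i. i \<in> I \<Longrightarrow> Ck k (f i)"
  shows "Ck k (\<lambda>x. \<Sum>i\<in>I. f i x)"
  using assms by (induction I rule: infinite_finite_induct) (auto intro: Ck_const Ck_add)

text \<open>\<open>Ck\<close> controls derivatives only in fixed directions. A direction depending
  linearly on \<open>x\<close> is expanded in the basis, with linear coefficients. The field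
  \<open>partial0\<close> has the direction \<open>x ** Zb 3\<close>.\<close>

lemma Ck_frechet_derivative_linear:
  fixes g :: "'a::euclidean_space \<Rightarrow> 'b::real_normed_vector"
  assumes "Ck (Suc k) g" "bounded_linear L"
  shows "Ck k (\<lambda>x. frechet_derivative g (at x) (L x))"
proof -
  have "frechet_derivative g (at x) (L x) =
      (\<Sum>b\<in>Basis. (L x \<bullet> b) *\<^sub>R frechet_derivative g (at x) b)" for x
  proof -
    have "linear (frechet_derivative g (at x))"
      using assms(1) by (auto intro: linear_frechet_derivative)
    then have "frechet_derivative g (at x) (\<Sum>b\<in>Basis. (L x \<bullet> b) *\<^sub>R b) =
      (\<Sum>b\<in>Basis. (L x \<bullet> b) *\<^sub>R frechet_derivative g (at x) b)"
      by (simp add: linear_sum linear_cmul)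
    then show ?thesis by (simp add: euclidean_representation)
  qed
  moreover have "Ck k (\<lambda>x. (L x \<bullet> b) *\<^sub>R frechet_derivative g (at x) b)" for b
  proof (rule Ck_bounded_bilinear[OF bounded_bilinear_scaleR])
    show "Ck k (\<lambda>x. L x \<bullet> b)"
      by (intro Ck_bounded_linear bounded_linear_compose[OF bounded_linear_inner_left assms(2)])
    show "Ck k (\<lambda>x. frechet_derivative g (at x) b)"
      using assms(1) by simp
  qed
  ultimately show ?thesis by (simp add: Ck_sum)
qed

text \<open>Differentiation under the integral sign gives two integrals of the same shape, with
  weights \<open>c * a\<close> and \<open>c * b\<close> and a directional derivative in place of
  \<open>g\<close>; so \<open>c\<close> and \<open>g\<close> vary in the induction. With
  \<open>J x = x ** Zb 3\<close> the argument of \<open>g\<close> is the torus flow, extended to all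
  matrices.\<close>

lemma Ck_integral_combination:
  fixes g :: "'a::euclidean_space \<Rightarrow> complex" and J :: "'a \<Rightarrow> 'a" and a b :: "real \<Rightarrow> real"
  assumes J: "bounded_linear J"
    and a: "continuous_on {0..T} a" and b: "continuous_on {0..T} b"
    and "continuous_on {0..T} c" "Ck k g"
  shows "Ck k (\<lambda>x. integral {0..T} (\<lambda>t. c t * g (a t *\<^sub>R x + b t *\<^sub>R J x)))"
  using assms(4,5)
proof (induction k arbitrary: c g)
  define U where "U = (UNIV :: 'a set) \<times> {0..T}"
  have pair: "continuous_on U (\<lambda>z. h (snd z))" if "continuous_on {0..T} h"
    for h :: "real \<Rightarrow> 'b::topological_space"
    by (rule continuous_on_compose2[OF that])
       (auto simp: U_def intro: continuous_intros)
  have M: "continuous_on U (\<lambda>z. a (snd z) *\<^sub>R fst z + b (snd z) *\<^sub>R J (fst z))"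
    by (intro continuous_intros pair a b bounded_linear.continuous_on[OF J])
  have gM: "continuous_on U (\<lambda>z. h (a (snd z) *\<^sub>R fst z + b (snd z) *\<^sub>R J (fst z)))"
    if "continuous_on UNIV h" for h :: "'a \<Rightarrow> complex"
    by (rule continuous_on_compose2[OF that M]) auto
  {
    case 0
    have "continuous_on U (\<lambda>z. c (snd z) * g (a (snd z) *\<^sub>R fst z + b (snd z) *\<^sub>R J (fst z)))"
      using 0 by (intro continuous_intros pair gM) auto
    then have "continuous_on UNIV
        (\<lambda>x. integral (cbox 0 T) (\<lambda>t. c t * g (a t *\<^sub>R x + b t *\<^sub>R J x)))"
      by (intro integral_continuous_on_param) (simp add: U_def case_prod_beta)
    then show ?case by simp
  next
    case (Suc k)
    define g' where "g' x = frechet_derivative g (at x)" for x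
    have g': "(g has_derivative g' x) (at x)" and kg': "Ck k (\<lambda>x. g' x v)" for x v
      using Suc.prems(2) unfolding g'_def by (auto simp flip: frechet_derivative_works)
    then have bl: "bounded_linear (g' x)" for x
      by (blast intro: has_derivative_bounded_linear)
    define M where "M x t = a t *\<^sub>R x + b t *\<^sub>R J x" for x t
    have blM: "bounded_linear (\<lambda>x. M x t)" for t
      unfolding M_def by (intro bounded_linear_add bounded_linear_const_scaleR J bounded_linear_ident)
    \<comment> \<open>The Leibniz rule wants the derivative of the integrand as a bounded linear map
      that is jointly continuous in \<open>x\<close> and \<open>t\<close>.\<close>
    define D where "D x t = Blinfun (\<lambda>v. c t * g' (M x t) (M v t))" for x t
    have D: "blinfun_apply (D x t) = (\<lambda>v. c t * g' (M x t) (M v t))" for x t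
      unfolding D_def
      by (intro bounded_linear_Blinfun_apply bounded_linear_const_mult
            bounded_linear_compose[OF bl blM])
    have gcont: "continuous_on UNIV g" using Suc.prems(2) by (rule Ck_imp_continuous_on)
    \<comment> \<open>Linearity replaces the direction \<open>M v t\<close>, which moves with
      \<open>t\<close>, by the fixed directions \<open>v\<close> and \<open>J v\<close>, to which
      the induction hypothesis applies.\<close>
    have split: "c t * g' (M x t) (M v t) =
        (c t * of_real (a t)) * g' (M x t) v + (c t * of_real (b t)) * g' (M x t) (J v)" for x t v
      using bl[of "M x t", THEN bounded_linear.linear]
      by (simp add: M_def[of v] linear_add linear_cmul scaleR_conv_of_real algebra_simps)
    have cont1: "continuous_on U (\<lambda>z. (c (snd z) * of_real (h (snd z))) * g' (M (fst z) (snd z)) v)"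
      if "continuous_on {0..T} h" for h v
      unfolding M_def using Suc.prems(1) that
      by (intro continuous_intros pair gM Ck_imp_continuous_on[OF kg']) auto
    \<comment> \<open>In finite dimension, continuity in operator norm follows from continuity on
      each basis vector.\<close>
    have cont: "continuous_on U (\<lambda>z. D (fst z) (snd z))"
      by (rule continuous_on_blinfun_componentwise)
         (auto simp: D split intro!: continuous_intros cont1 a b)
    have slice: "continuous_on {0..T} (\<lambda>t. h (x, t))" if "continuous_on U h"
      for h :: "_ \<Rightarrow> complex" and x
      by (rule continuous_on_compose2[OF that]) (auto simp: U_def intro: continuous_intros)
    have int: "(\<lambda>t. (c t * of_real (h t)) * g' (M x t) v) integrable_on {0..T}"
      if "continuous_on {0..T} h" for h v x
      using slice[OF cont1[OF that], of x v] by (auto intro: integrable_continuous_real)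
    have "continuous_on U (\<lambda>z. c (snd z) * g (M (fst z) (snd z)))"
      unfolding M_def using Suc.prems(1) by (intro continuous_intros pair gM gcont)
    from slice[OF this] have int0: "(\<lambda>t. c t * g (M x t)) integrable_on {0..T}" for x
      by (auto intro: integrable_continuous_real)
    have der: "((\<lambda>x. integral (cbox 0 T) (\<lambda>t. c t * g (M x t))) has_derivative
          blinfun_apply (integral (cbox 0 T) (D x))) (at x within UNIV)" for x
    proof (rule leibniz_rule)
      show "((\<lambda>x. c t * g (M x t)) has_derivative blinfun_apply (D x t)) (at x within UNIV)"
        for x t
        unfolding D
        by (auto intro!: has_derivative_mult_right
            has_derivative_compose[OF bounded_linear_imp_has_derivative[OF blM] g'])
    qed (use cont int0 in \<open>auto simp: U_def case_prod_beta\<close>)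
    have "(D x) integrable_on {0..T}" for x
    proof -
      have "continuous_on {0..T} (D x)"
        by (rule continuous_on_compose2[OF cont, of _ "\<lambda>t. (x, t)", simplified])
           (auto simp: U_def intro: continuous_intros)
      then show ?thesis by (rule integrable_continuous_real)
    qed
    then have "blinfun_apply (integral {0..T} (D x)) v = integral {0..T} (\<lambda>t. D x t v)" for x v
      by (metis blinfun_apply_integral)
    then have val: "blinfun_apply (integral {0..T} (D x)) v =
        integral {0..T} (\<lambda>t. (c t * of_real (a t)) * g' (M x t) v) +
        integral {0..T} (\<lambda>t. (c t * of_real (b t)) * g' (M x t) (J v))" for x v
      by (simp add: D split integral_add int a b)
    show ?case
    proof (rule Ck_SucI)
      show "((\<lambda>x. integral {0..T} (\<lambda>t. c t * g (a t *\<^sub>R x + b t *\<^sub>R J x))) has_derivative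
          blinfun_apply (integral {0..T} (D x))) (at x)" for x
        using der[of x] by (simp add: M_def)
      show "Ck k (\<lambda>x. blinfun_apply (integral {0..T} (D x)) v)" for v
        unfolding val M_def using a b Suc.prems(1)
        by (intro Ck_add Suc.IH kg' continuous_intros)
    qed
  }
qed

section \<open>Differentiation along the torus flow\<close>

lemma cmat_eq_iff:
  "(A::cmat) = B \<longleftrightarrow> A$1$1 = B$1$1 \<and> A$1$2 = B$1$2 \<and> A$2$1 = B$2$1 \<and> A$2$2 = B$2$2"
  by (auto simp: vec_eq_iff forall_2)

lemma adj_mult: "adj (A ** B) = adj B ** adj A"
  by (simp add: cmat_eq_iff adj_def matrix_matrix_mult_def sum_2 mult.commute)

lemma SU2_mult: "A \<in> SU2 \<Longrightarrow> B \<in> SU2 \<Longrightarrow> A ** B \<in> SU2"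
  unfolding SU2_def
  by (auto simp: adj_mult det_mul) (metis matrix_mul_assoc matrix_mul_rid)

text \<open>The half angles on the diagonal are the source of the period \<open>4 * pi\<close> and
  of half-integer frequencies.\<close>

lemma expZ_entries:
  "expZ 3 t = (\<chi> i j. if i = j then (if i = 1 then cis (t/2) else cis (- (t/2))) else 0)"
  by (simp add: cmat_eq_iff expZ_def Zb_def mat_def complex_eq_iff)

lemma su2_of_in_SU2: "norm z = 1 \<Longrightarrow> su2_of z \<in> SU2"
proof -
  assume "norm z = 1"
  then have "(cmod (fst z))\<^sup>2 + (cmod (snd z))\<^sup>2 = 1"
    by (simp add: norm_prod_def)
  then have "fst z * cnj (fst z) + snd z * cnj (snd z) = 1"
    by (simp flip: complex_norm_square of_real_add of_real_power)
  then show ?thesis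
    by (simp add: SU2_def su2_of_def cmat_eq_iff adj_def matrix_matrix_mult_def sum_2 det_2 mat_def
        algebra_simps)
qed

lemma expZ_in_SU2: "expZ j t \<in> SU2"
proof -
  define c s where "c = cos (t/2)" "s = sin (t/2)"
  have cs: "c\<^sup>2 + s\<^sup>2 = 1"
    by (simp add: c_s_def)
  \<comment> \<open>The first column of \<open>expZ j t\<close>, which determines an element of
    SU(2). As in \<open>Zb\<close>, every index other than 1 and 2 counts as 3.\<close>
  define z where "z = (if j = 1 then (complex_of_real c, \<i> * complex_of_real s)
    else if j = 2 then (complex_of_real c, - complex_of_real s) else (Complex c s, 0))"
  have "expZ j t = su2_of z"
    by (simp add: z_def expZ_def Zb_def su2_of_def mat_def cmat_eq_iff complex_eq_iff flip: c_s_def)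
  moreover have "norm z = 1"
    using cs by (simp add: z_def norm_prod_def norm_mult cmod_def)
  ultimately show ?thesis by (simp add: su2_of_in_SU2)
qed

lemma mat1_in_SU2: "mat 1 \<in> SU2"
  by (simp add: SU2_def adj_def cmat_eq_iff matrix_matrix_mult_def sum_2 mat_def det_2)

lemma SU2_mult_expZ: "x \<in> SU2 \<Longrightarrow> x ** expZ j t \<in> SU2"
  by (intro SU2_mult expZ_in_SU2)

lemma expZ_add: "expZ 3 s ** expZ 3 t = expZ 3 (s + t)"
  by (simp add: expZ_entries cmat_eq_iff matrix_matrix_mult_def sum_2 cis_mult add_divide_distrib)

lemma expZ_0: "expZ 3 0 = mat 1"
  by (simp add: expZ_entries cmat_eq_iff mat_def)

lemma expZ_4pi: "expZ 3 (4 * pi) = mat 1"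
  by (simp add: expZ_entries cmat_eq_iff mat_def complex_eq_iff)

text \<open>For fixed \<open>t\<close> the flow is linear in the matrix, so it makes sense off the
  group as well; this is the shape that \<open>Ck_integral_combination\<close> takes.\<close>

lemma mult_expZ: "(x::cmat) ** expZ 3 t = cos (t/2) *\<^sub>R x + (2 * sin (t/2)) *\<^sub>R (x ** Zb 3)"
  unfolding cmat_eq_iff vector_add_component vector_scaleR_component
  by (simp add: expZ_def matrix_matrix_mult_def sum_2 mat_def scaleR_conv_of_real algebra_simps)

lemma bounded_linear_mult_right: "bounded_linear (\<lambda>x::cmat. x ** (B::cmat))"
  by (rule linear_conv_bounded_linear[THEN iffD1], rule linearI)
     (unfold cmat_eq_iff vector_add_component vector_scaleR_component,
      simp_all add: matrix_matrix_mult_def sum_2 algebra_simps)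

lemma has_vector_derivative_mult_expZ:
  "((\<lambda>t. (x::cmat) ** expZ 3 t) has_vector_derivative (x ** expZ 3 s) ** Zb 3) (at s)"
proof -
  have "x ** expZ 3 s ** Zb 3 = (- sin (s/2) / 2) *\<^sub>R x + (cos (s/2)) *\<^sub>R (x ** Zb 3)"
    unfolding cmat_eq_iff vector_add_component vector_scaleR_component
    by (simp add: expZ_def Zb_def matrix_matrix_mult_def sum_2 mat_def
        scaleR_conv_of_real algebra_simps)
  then show ?thesis
    unfolding mult_expZ[of x] by (auto intro!: derivative_eq_intros)
qed

lemma continuous_mult_expZ: "continuous_on S (\<lambda>t. (x::cmat) ** expZ 3 t)"
  using has_vector_derivative_mult_expZ
  by (auto intro!: continuous_at_imp_continuous_on has_vector_derivative_continuous)

text \<open>The curve \<open>x ** expZ j t\<close> never leaves the group, so values elsewhere do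
  not enter.\<close>

lemma lider_cong:
  assumes "\<And>y. y \<in> SU2 \<Longrightarrow> f y = g y" "x \<in> SU2"
  shows "lider j f x = lider j g x"
  unfolding lider_def using assms by (simp add: SU2_mult_expZ)

lemma liderw_cong:
  assumes "\<And>y. y \<in> SU2 \<Longrightarrow> f y = g y" "x \<in> SU2"
  shows "liderw w f x = liderw w g x"
  using assms(2) by (induction w arbitrary: x) (auto intro: lider_cong assms(1))

lemma liderw_zero: "liderw w (\<lambda>x. 0) = (\<lambda>x. 0)"
  by (induction w) (auto simp: lider_def fun_eq_iff)

lemma seminorm_k_eq_0:
  assumes "\<And>x. x \<in> SU2 \<Longrightarrow> f x = 0"
  shows "seminorm_k k f = 0"
proof -
  have "(SUP x\<in>SU2. cmod (liderw w f x)) = 0" for w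
  proof -
    \<comment> \<open>\<open>mat 1\<close> witnesses that the group is nonempty; the image must be
      \<open>{0}\<close> rather than empty for the supremum to be 0.\<close>
    have "(\<lambda>x. cmod (liderw w f x)) ` SU2 = {0}"
      using liderw_cong[of f "\<lambda>x. 0" _ w] assms mat1_in_SU2 by (auto simp: liderw_zero image_iff)
    then show ?thesis by simp
  qed
  then show ?thesis by (simp add: seminorm_k_def)
qed

section \<open>Smooth functions on SU(2) and the neutral derivative\<close>

lemma smooth_su2E:
  assumes "smooth_su2 f"
  obtains g where "smooth_amb g" "\<And>x. x \<in> SU2 \<Longrightarrow> f x = g x"
  using assms unfolding smooth_su2_def by metis

lemma smooth_su2I:
  assumes "\<And>k. Ck k g" "\<And>x. x \<in> SU2 \<Longrightarrow> f x = g x"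
  shows "smooth_su2 f"
  using assms unfolding smooth_su2_def smooth_amb_def by metis

lemma smooth_su2_cong:
  assumes "smooth_su2 f" "\<And>x. x \<in> SU2 \<Longrightarrow> g x = f x"
  shows "smooth_su2 g"
  using assms unfolding smooth_su2_def by metis

lemma smooth_su2_const: "smooth_su2 (\<lambda>x. c)"
  by (rule smooth_su2I[of "\<lambda>x. c"]) (auto intro: Ck_const)

lemma smooth_su2_add:
  assumes "smooth_su2 f" "smooth_su2 g"
  shows "smooth_su2 (\<lambda>x. f x + g x)"
  using assms
  by (elim smooth_su2E, intro smooth_su2I) (auto intro: Ck_add simp: smooth_amb_def)

lemma smooth_su2_mult:
  assumes "smooth_su2 f" "smooth_su2 g"
  shows "smooth_su2 (\<lambda>x. f x * g x)"
  using assms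
  by (elim smooth_su2E, intro smooth_su2I)
     (auto intro: Ck_bounded_bilinear[OF bounded_bilinear_mult] simp: smooth_amb_def)

lemma smooth_su2_cmult: "smooth_su2 f \<Longrightarrow> smooth_su2 (\<lambda>x. c * f x)"
  by (rule smooth_su2_mult[OF smooth_su2_const])

lemma smooth_su2_diff:
  assumes "smooth_su2 f" "smooth_su2 g"
  shows "smooth_su2 (\<lambda>x. f x - g x)"
  using smooth_su2_add[OF assms(1) smooth_su2_cmult[OF assms(2), of "-1"]] by simp

lemma smooth_su2_power: "smooth_su2 f \<Longrightarrow> smooth_su2 (\<lambda>x. f x ^ n)"
  by (induction n) (auto intro: smooth_su2_const smooth_su2_mult)

lemma smooth_su2_entry: "smooth_su2 (\<lambda>x. x $ i $ j)"
  by (rule smooth_su2I[OF Ck_bounded_linear])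
     (auto intro: bounded_linear_compose[OF bounded_linear_vec_nth bounded_linear_vec_nth])

lemma smooth_su2_cnj: "smooth_su2 f \<Longrightarrow> smooth_su2 (\<lambda>x. cnj (f x))"
  by (elim smooth_su2E, intro smooth_su2I)
     (auto intro: Ck_bounded_linear_compose[OF bounded_linear_cnj] simp: smooth_amb_def)

lemmas smooth_su2_intros = smooth_su2_const smooth_su2_add smooth_su2_mult smooth_su2_diff
  smooth_su2_power smooth_su2_entry smooth_su2_cnj

lemma smooth_su2_imp_continuous_on: "smooth_su2 f \<Longrightarrow> continuous_on SU2 f"
  by (metis Ck_imp_continuous_on continuous_on_cong smooth_amb_def smooth_su2E)

text \<open>Chain rule for the ambient extension \<open>g\<close> along a flow line, on which
  \<open>f\<close> and \<open>g\<close> agree.\<close>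

lemma partial0_extension:
  assumes "smooth_amb g" "\<And>x. x \<in> SU2 \<Longrightarrow> f x = g x" "x \<in> SU2"
  shows "((\<lambda>t. f (x ** expZ 3 t)) has_vector_derivative
      frechet_derivative g (at (x ** expZ 3 s)) (x ** expZ 3 s ** Zb 3)) (at s)"
proof -
  have "Ck (Suc 0) g"
    using assms(1) smooth_amb_def by blast
  then have "(g has_derivative frechet_derivative g (at (x ** expZ 3 s))) (at (x ** expZ 3 s))"
    by (simp flip: frechet_derivative_works)
  from vector_derivative_diff_chain_within[OF has_vector_derivative_mult_expZ
      has_derivative_at_withinI[OF this]]
  have "((\<lambda>t. g (x ** expZ 3 t)) has_vector_derivative
      frechet_derivative g (at (x ** expZ 3 s)) (x ** expZ 3 s ** Zb 3)) (at s)"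
    by (simp add: o_def)
  then show ?thesis
    using assms by (simp add: SU2_mult_expZ)
qed

lemma partial0_eq_frechet_derivative:
  assumes "smooth_amb g" "\<And>x. x \<in> SU2 \<Longrightarrow> f x = g x" "x \<in> SU2"
  shows "partial0 f x = frechet_derivative g (at x) (x ** Zb 3)"
  unfolding lider_def using vector_derivative_at[OF partial0_extension[OF assms, of 0]]
  by (simp add: expZ_0)

lemma has_vector_derivative_partial0:
  assumes "smooth_su2 f" "x \<in> SU2"
  shows "((\<lambda>t. f (x ** expZ 3 t)) has_vector_derivative partial0 f (x ** expZ 3 s)) (at s)"
proof -
  obtain g where g: "smooth_amb g" "\<And>x. x \<in> SU2 \<Longrightarrow> f x = g x"
    using smooth_su2E[OF assms(1)] by metis
  show ?thesis
    using partial0_extension[OF g assms(2), of s]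
    by (simp add: partial0_eq_frechet_derivative[OF g SU2_mult_expZ[OF assms(2)]])
qed

lemma partial0_eqI:
  assumes "((\<lambda>t. f (x ** expZ 3 t)) has_vector_derivative d) (at 0)"
  shows "partial0 f x = d"
  using assms by (simp add: lider_def vector_derivative_at)

lemma has_vector_derivative_partial0_at_0:
  assumes "smooth_su2 f" "x \<in> SU2"
  shows "((\<lambda>t. f (x ** expZ 3 t)) has_vector_derivative partial0 f x) (at 0)"
  using has_vector_derivative_partial0[OF assms, of 0] by (simp add: expZ_0)

text \<open>The derivative of an ambient extension in the direction \<open>x ** Zb 3\<close> is
  defined for all matrices and is therefore a smooth extension of \<open>partial0 f\<close>.\<close>

lemma smooth_su2_partial0:
  assumes "smooth_su2 f"
  shows "smooth_su2 (partial0 f)"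
proof -
  obtain g where g: "smooth_amb g" "\<And>x. x \<in> SU2 \<Longrightarrow> f x = g x"
    using smooth_su2E[OF assms] by metis
  then have "Ck k (\<lambda>x. frechet_derivative g (at x) (x ** Zb 3))" for k
    by (intro Ck_frechet_derivative_linear bounded_linear_mult_right)
       (simp add: smooth_amb_def del: Ck.simps)
  then show ?thesis
    using partial0_eq_frechet_derivative[OF g] by (rule smooth_su2I)
qed

lemma partial0_mult:
  assumes "smooth_su2 f" "smooth_su2 g" "x \<in> SU2"
  shows "partial0 (\<lambda>x. f x * g x) x = f x * partial0 g x + partial0 f x * g x"
  using has_vector_derivative_mult[OF has_vector_derivative_partial0_at_0[OF assms(1,3)]
      has_vector_derivative_partial0_at_0[OF assms(2,3)]]
  by (intro partial0_eqI) (simp add: expZ_0)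

lemma partial0_const: "partial0 (\<lambda>x. c) x = 0"
  by (rule partial0_eqI) simp

lemma partial0_add:
  assumes "smooth_su2 f" "smooth_su2 g" "x \<in> SU2"
  shows "partial0 (\<lambda>x. f x + g x) x = partial0 f x + partial0 g x"
  using has_vector_derivative_add[OF has_vector_derivative_partial0_at_0[OF assms(1,3)]
      has_vector_derivative_partial0_at_0[OF assms(2,3)]]
  by (intro partial0_eqI) simp

lemma partial0_cmult:
  assumes "smooth_su2 f" "x \<in> SU2"
  shows "partial0 (\<lambda>x. c * f x) x = c * partial0 f x"
  using partial0_mult[OF smooth_su2_const[of c] assms] by (simp add: partial0_const)

lemma partial0_cnj:
  assumes "smooth_su2 f" "x \<in> SU2"
  shows "partial0 (\<lambda>x. cnj (f x)) x = cnj (partial0 f x)"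
  using has_vector_derivative_partial0_at_0[OF assms]
  by (intro partial0_eqI has_vector_derivative_cnj)

lemma continuous_on_expZ_compose:
  assumes "smooth_su2 f" "x \<in> SU2"
  shows "continuous_on S (\<lambda>t. f (x ** expZ 3 t))"
  by (rule continuous_on_compose2[OF smooth_su2_imp_continuous_on[OF assms(1)]
        continuous_mult_expZ]) (use assms(2) in \<open>auto intro: SU2_mult_expZ\<close>)

section \<open>Solving the first-order equation along closed orbits\<close>

text \<open>Averaging \<open>\<phi>\<close> over its orbit with weight
  \<open>exp (- \<mu> * t)\<close> and integrating by parts over one period leaves only boundary
  terms. The orbit closes up, so these are \<open>\<phi> x\<close> times
  \<open>exp (- 4 * pi * \<mu>) - 1\<close>, a nonzero factor that can be divided out.\<close>

lemma partial0_solvable: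
  fixes \<mu> :: complex
  assumes \<phi>: "smooth_su2 \<phi>" and \<mu>: "exp (4 * complex_of_real pi * \<mu>) \<noteq> 1"
  shows "\<exists>\<psi>. smooth_su2 \<psi> \<and> (\<forall>x\<in>SU2. partial0 \<psi> x - \<mu> * \<psi> x = \<phi> x)"
proof -
  define K where "K h x = integral {0..4*pi} (\<lambda>t. exp (- \<mu> * t) * h (x ** expZ 3 t))"
    for h :: "cmat \<Rightarrow> complex" and x
  have ce: "continuous_on S (\<lambda>t::real. exp (- \<mu> * complex_of_real t))" for S
    by (intro continuous_intros)
  have smooth: "smooth_su2 (K \<phi>)"
  proof -
    obtain g where g: "smooth_amb g" "\<And>x. x \<in> SU2 \<Longrightarrow> \<phi> x = g x"
      using smooth_su2E[OF \<phi>] by metis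
    \<comment> \<open>The integral with the extension \<open>g\<close> and the linear formula for
      the flow is a smooth extension of \<open>K \<phi>\<close>.\<close>
    have "Ck k (\<lambda>x. integral {0..4*pi} (\<lambda>t. exp (- \<mu> * t) *
        g (cos (t/2) *\<^sub>R x + (2 * sin (t/2)) *\<^sub>R (x ** Zb 3))))" for k
    proof (rule Ck_integral_combination)
      show "continuous_on {0..4*pi} (\<lambda>t. exp (- \<mu> * complex_of_real t))" by (rule ce)
      show "Ck k g" using g(1) by (simp add: smooth_amb_def)
    qed (auto intro!: bounded_linear_mult_right continuous_intros)
    then show ?thesis
      by (rule smooth_su2I) (auto simp: K_def g(2) SU2_mult_expZ mult_expZ[symmetric])
  qed
  have D: "partial0 (K \<phi>) x = K (partial0 \<phi>) x" if x: "x \<in> SU2" for x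
  proof (rule partial0_eqI)
    \<comment> \<open>\<open>K\<close> commutes with the flow derivative: moving \<open>x\<close> by
      \<open>s\<close> only shifts the flow time, and the shift is differentiated under the
      integral.\<close>
    have "((\<lambda>s. integral (cbox 0 (4*pi)) (\<lambda>t. exp (- \<mu> * t) * \<phi> (x ** expZ 3 (s + t))))
        has_vector_derivative
        integral (cbox 0 (4*pi)) (\<lambda>t. exp (- \<mu> * t) * partial0 \<phi> (x ** expZ 3 (0 + t)))) (at 0)"
    proof (rule leibniz_rule_vector_derivative[where U=UNIV])
      fix s t :: real
      have "((\<lambda>s. \<phi> (x ** expZ 3 s)) \<circ> (\<lambda>s. s + t) has_vector_derivative
          1 *\<^sub>R partial0 \<phi> (x ** expZ 3 (s + t))) (at s)"
        by (rule vector_diff_chain_at)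
           (auto intro!: derivative_eq_intros has_vector_derivative_partial0 \<phi> x)
      then show "((\<lambda>s. exp (- \<mu> * t) * \<phi> (x ** expZ 3 (s + t))) has_vector_derivative
          exp (- \<mu> * t) * partial0 \<phi> (x ** expZ 3 (s + t))) (at s)"
        by (intro has_vector_derivative_mult_right) (simp add: o_def)
    next
      fix s :: real
      have "continuous_on {0..4*pi} (\<lambda>t. \<phi> (x ** expZ 3 (s + t)))"
        by (rule continuous_on_compose2[OF continuous_on_expZ_compose[OF \<phi> x, of UNIV]])
           (auto intro: continuous_intros)
      then have "continuous_on {0..4*pi} (\<lambda>t. exp (- \<mu> * t) * \<phi> (x ** expZ 3 (s + t)))"
        by (intro continuous_on_mult ce)
      then show "(\<lambda>t. exp (- \<mu> * t) * \<phi> (x ** expZ 3 (s + t))) integrable_on cbox 0 (4*pi)"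
        by (simp add: integrable_continuous_real)
    next
      have "continuous_on (UNIV \<times> cbox 0 (4*pi))
          (\<lambda>z::real \<times> real. partial0 \<phi> (x ** expZ 3 (fst z + snd z)))"
        by (rule continuous_on_compose2[OF
              continuous_on_expZ_compose[OF smooth_su2_partial0[OF \<phi>] x, of UNIV]])
           (auto intro!: continuous_intros)
      then show "continuous_on (UNIV \<times> cbox 0 (4*pi))
          (\<lambda>(s, t). exp (- \<mu> * t) * partial0 \<phi> (x ** expZ 3 (s + t)))"
        by (auto simp: case_prod_beta intro!: continuous_intros)
    qed auto
    moreover have "x ** expZ 3 s ** expZ 3 t = x ** expZ 3 (s + t)" for s t
      by (metis expZ_add matrix_mul_assoc)
    ultimately show "((\<lambda>s. K \<phi> (x ** expZ 3 s)) has_vector_derivative K (partial0 \<phi>) x) (at 0)"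
      by (simp add: K_def)
  qed
  have eq: "partial0 (K \<phi>) x - \<mu> * K \<phi> x = (exp (- \<mu> * (4 * pi)) - 1) * \<phi> x"
    if x: "x \<in> SU2" for x
  proof -
    have ci: "continuous_on {0..4*pi} (\<lambda>t. exp (- \<mu> * t) * h (x ** expZ 3 t))"
      if "smooth_su2 h" for h
      by (intro continuous_on_mult ce continuous_on_expZ_compose[OF that x])
    \<comment> \<open>The integrand is the derivative of
      \<open>exp (- \<mu> * t) * \<phi> (x ** expZ 3 t)\<close>.\<close>
    have "((\<lambda>t. exp (- \<mu> * t) * partial0 \<phi> (x ** expZ 3 t)
          - \<mu> * (exp (- \<mu> * t) * \<phi> (x ** expZ 3 t))) has_integral
        exp (- \<mu> * complex_of_real (4*pi)) * \<phi> (x ** expZ 3 (4*pi))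
         - exp (- \<mu> * complex_of_real 0) * \<phi> (x ** expZ 3 0)) {0..4*pi}"
    proof (rule fundamental_theorem_of_calculus)
      fix t :: real
      have "((\<lambda>t. exp (- \<mu> * complex_of_real t)) has_vector_derivative
          - \<mu> * exp (- \<mu> * t)) (at t)"
        by (rule has_vector_derivative_real_field[of "\<lambda>z. exp (- \<mu> * z)"])
           (auto intro!: derivative_eq_intros)
      note d = has_vector_derivative_mult[OF this has_vector_derivative_partial0[OF \<phi> x, of t]]
      show "((\<lambda>t. exp (- \<mu> * t) * \<phi> (x ** expZ 3 t)) has_vector_derivative
         exp (- \<mu> * t) * partial0 \<phi> (x ** expZ 3 t)
          - \<mu> * (exp (- \<mu> * t) * \<phi> (x ** expZ 3 t))) (at t within {0..4*pi})"
        by (rule has_vector_derivative_at_within) (use d in \<open>simp add: algebra_simps\<close>)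
    qed auto
    then have "integral {0..4*pi} (\<lambda>t. exp (- \<mu> * t) * partial0 \<phi> (x ** expZ 3 t)
          - \<mu> * (exp (- \<mu> * t) * \<phi> (x ** expZ 3 t))) = (exp (- \<mu> * (4 * pi)) - 1) * \<phi> x"
      by (simp add: integral_unique expZ_0 expZ_4pi left_diff_distrib)
    moreover have "integral {0..4*pi} (\<lambda>t. exp (- \<mu> * t) * partial0 \<phi> (x ** expZ 3 t)
          - \<mu> * (exp (- \<mu> * t) * \<phi> (x ** expZ 3 t))) = K (partial0 \<phi>) x - \<mu> * K \<phi> x"
      unfolding K_def using ci[OF \<phi>] ci[OF smooth_su2_partial0[OF \<phi>]]
      by (subst integral_diff)
         (auto intro!: integrable_continuous_real continuous_on_mult_left)
    ultimately show ?thesis using D[OF x] by simp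
  qed
  define c where "c = exp (- \<mu> * (4 * pi)) - 1"
  have "c \<noteq> 0"
    using \<mu> by (simp add: c_def exp_minus mult.commute mult.left_commute)
  then have "partial0 (\<lambda>x. inverse c * K \<phi> x) x - \<mu> * (inverse c * K \<phi> x) = \<phi> x"
    if "x \<in> SU2" for x
  proof -
    have "partial0 (\<lambda>x. inverse c * K \<phi> x) x - \<mu> * (inverse c * K \<phi> x) =
        inverse c * (partial0 (K \<phi>) x - \<mu> * K \<phi> x)"
      by (simp add: partial0_cmult[OF smooth that] algebra_simps)
    then show ?thesis
      using eq[OF that] \<open>c \<noteq> 0\<close> by (simp add: c_def)
  qed
  then show ?thesis
    using smooth_su2_cmult[OF smooth] by blast
qed

section \<open>Haar integral\<close>

text \<open>On each horizontal line the shear is a translation, so Fubini reduces the claim to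
  translation invariance in one variable.\<close>

lemma lborel_shear_fst:
  "distr lborel borel (\<lambda>z::real \<times> real. (fst z + c * snd z, snd z)) = lborel"
proof (rule measure_eqI)
  fix A assume "A \<in> sets (distr lborel borel (\<lambda>z::real \<times> real. (fst z + c * snd z, snd z)))"
  then have A[measurable]: "A \<in> sets borel" by simp
  have [measurable]: "A \<in> sets (lborel \<Otimes>\<^sub>M lborel)"
    using A by (simp only: lborel_prod sets_lborel)
  have [measurable]: "(\<lambda>z::real \<times> real. (fst z + c * snd z, snd z)) \<in> borel \<rightarrow>\<^sub>M borel"
    by (intro borel_measurable_continuous_onI continuous_intros)
  have "emeasure (distr lborel borel (\<lambda>z. (fst z + c * snd z, snd z))) A =
      (\<integral>\<^sup>+z. indicator A (fst z + c * snd z, snd z) \<partial>(lborel :: (real \<times> real) measure))"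
    by (subst nn_integral_indicator[symmetric], simp, subst nn_integral_distr) auto
  also have "\<dots> = (\<integral>\<^sup>+y. \<integral>\<^sup>+x. indicator A (x + c * y, y) \<partial>lborel \<partial>(lborel :: real measure))"
    by (subst lborel_prod[symmetric], subst lborel_pair.nn_integral_snd[symmetric])
       (auto simp: lborel_prod)
  also have "\<dots> = (\<integral>\<^sup>+y. \<integral>\<^sup>+x. indicator A (x, y) \<partial>lborel \<partial>(lborel :: real measure))"
  proof (rule nn_integral_cong)
    fix y :: real
    show "(\<integral>\<^sup>+x. indicator A (x + c * y, y) \<partial>lborel) =
        (\<integral>\<^sup>+x. indicator A (x, y) \<partial>(lborel::real measure))"
      by (subst (2) nn_integral_real_affine[where c=1 and t="c * y"]) (auto simp: add.commute)
  qed
  also have "\<dots> = emeasure lborel A"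
    by (subst lborel_pair.nn_integral_snd)
       (auto simp: lborel_prod)
  finally show "emeasure (distr lborel borel (\<lambda>z. (fst z + c * snd z, snd z))) A =
      emeasure lborel A" .
qed simp

lemma lborel_shear_snd:
  "distr lborel borel (\<lambda>z::real \<times> real. (fst z, snd z + c * fst z)) = lborel"
proof (rule measure_eqI)
  fix A assume "A \<in> sets (distr lborel borel (\<lambda>z::real \<times> real. (fst z, snd z + c * fst z)))"
  then have A[measurable]: "A \<in> sets borel" by simp
  have [measurable]: "A \<in> sets (lborel \<Otimes>\<^sub>M lborel)"
    using A by (simp only: lborel_prod sets_lborel)
  have [measurable]: "(\<lambda>z::real \<times> real. (fst z, snd z + c * fst z)) \<in> borel \<rightarrow>\<^sub>M borel"
    by (intro borel_measurable_continuous_onI continuous_intros)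
  have "emeasure (distr lborel borel (\<lambda>z. (fst z, snd z + c * fst z))) A =
      (\<integral>\<^sup>+z. indicator A (fst z, snd z + c * fst z) \<partial>(lborel :: (real \<times> real) measure))"
    by (subst nn_integral_indicator[symmetric], simp, subst nn_integral_distr) auto
  also have "\<dots> = (\<integral>\<^sup>+x. \<integral>\<^sup>+y. indicator A (x, y + c * x) \<partial>lborel \<partial>(lborel :: real measure))"
    by (subst lborel_prod[symmetric], subst lborel.nn_integral_fst[symmetric])
       (auto simp: lborel_prod)
  also have "\<dots> = (\<integral>\<^sup>+x. \<integral>\<^sup>+y. indicator A (x, y) \<partial>lborel \<partial>(lborel :: real measure))"
  proof (rule nn_integral_cong)
    fix x :: real
    show "(\<integral>\<^sup>+y. indicator A (x, y + c * x) \<partial>lborel) =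
        (\<integral>\<^sup>+y. indicator A (x, y) \<partial>(lborel::real measure))"
      by (subst (2) nn_integral_real_affine[where c=1 and t="c * x"]) (auto simp: add.commute)
  qed
  also have "\<dots> = emeasure lborel A"
    by (subst lborel.nn_integral_fst)
       (auto simp: lborel_prod)
  finally show "emeasure (distr lborel borel (\<lambda>z. (fst z, snd z + c * fst z))) A =
      emeasure lborel A" .
qed simp

text \<open>A rotation other than the half turn is a product of three shears.\<close>

lemma lborel_rotation:
  fixes a b :: real
  assumes "a\<^sup>2 + b\<^sup>2 = 1" "a \<noteq> -1"
  shows "distr lborel borel (\<lambda>z::real \<times> real. (a * fst z - b * snd z, b * fst z + a * snd z)) = lborel"
proof -
  \<comment> \<open>For the angle \<open>t\<close> with \<open>a = cos t\<close> and
    \<open>b = sin t\<close> this is \<open>- tan (t / 2)\<close>, which has its pole at the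
    excluded half turn. The two outer shears use \<open>c\<close>, the middle one
    \<open>b\<close>.\<close>
  define c where "c = - b / (1 + a)"
  have ab: "1 + c * b = a" "c * a + c = - b"
  proof -
    have "1 + a \<noteq> 0" using assms(2) by linarith
    then show "1 + c * b = a"
      using assms(1) by (simp add: c_def field_simps power2_eq_square)
    have "c * (1 + a) = - b" using \<open>1 + a \<noteq> 0\<close> by (simp add: c_def)
    then show "c * a + c = - b" by (simp add: algebra_simps)
  qed
  let ?S = "\<lambda>z::real \<times> real. (fst z + c * snd z, snd z)"
  let ?T = "\<lambda>z::real \<times> real. (fst z, snd z + b * fst z)"
  have [measurable]: "?S \<in> borel \<rightarrow>\<^sub>M borel" "?T \<in> borel \<rightarrow>\<^sub>M borel"
    by (intro borel_measurable_continuous_onI continuous_intros)+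
  have "(\<lambda>z. (a * fst z - b * snd z, b * fst z + a * snd z)) = ?S \<circ> ?T \<circ> ?S"
  proof
    fix z :: "real \<times> real"
    have "fst z + c * snd z + c * (snd z + b * (fst z + c * snd z)) =
        (1 + c * b) * fst z + (c * (1 + c * b) + c) * snd z"
      by (simp add: algebra_simps)
    moreover have "snd z + b * (fst z + c * snd z) = b * fst z + (1 + c * b) * snd z"
      by (simp add: algebra_simps)
    ultimately show "(a * fst z - b * snd z, b * fst z + a * snd z) = (?S \<circ> ?T \<circ> ?S) z"
      using ab by simp
  qed
  moreover have "distr lborel borel (?S \<circ> ?T \<circ> ?S) =
      distr (distr (distr lborel borel ?S) borel ?T) borel ?S"
    by (simp add: distr_distr comp_assoc)
  ultimately show ?thesis
    by (simp only: lborel_shear_fst lborel_shear_snd)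
qed

text \<open>Boxes pull back to boxes with equal side lengths, and boxes determine Lebesgue measure.
  This carries the rotation result over from the real plane.\<close>

lemma lborel_complex:
  "distr lborel borel (\<lambda>z::real \<times> real. Complex (fst z) (snd z)) = lborel"
proof (rule lborel_eqI[symmetric])
  have [measurable]: "(\<lambda>z::real \<times> real. Complex (fst z) (snd z)) \<in> borel \<rightarrow>\<^sub>M borel"
    by (intro borel_measurable_continuous_onI continuous_intros)
  fix l u :: complex
  assume lu: "\<And>b. b \<in> Basis \<Longrightarrow> l \<bullet> b \<le> u \<bullet> b"
  have "(\<lambda>z::real \<times> real. Complex (fst z) (snd z)) -` box l u = box (Re l, Im l) (Re u, Im u)"
    by (auto simp: box_def Basis_complex_def Basis_prod_def inner_complex_def)
  then have "emeasure (distr lborel borel (\<lambda>z. Complex (fst z) (snd z))) (box l u) =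
      emeasure lborel (box (Re l, Im l) (Re u, Im u))"
    by (subst emeasure_distr) auto
  also have "\<dots> = (\<Prod>b\<in>Basis. ((Re u, Im u) - (Re l, Im l)) \<bullet> b)"
    using lu[of 1] lu[of \<i>] by (intro emeasure_lborel_box)
      (auto simp: Basis_complex_def Basis_prod_def inner_complex_def)
  also have "(\<Prod>b\<in>Basis. ((Re u, Im u) - (Re l, Im l)) \<bullet> b) = (\<Prod>b\<in>Basis. (u - l) \<bullet> b)"
    by (simp add: Basis_complex_def Basis_prod_def inner_complex_def prod.union_disjoint insert_commute)
  finally show "emeasure (distr lborel borel (\<lambda>z. Complex (fst z) (snd z))) (box l u) =
      (\<Prod>b\<in>Basis. (u - l) \<bullet> b)" .
qed simp

lemma lborel_cmult:
  fixes w :: complex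
  assumes "cmod w = 1" "w \<noteq> -1"
  shows "distr lborel borel (\<lambda>z. w * z) = lborel"
proof -
  let ?C = "\<lambda>z::real \<times> real. Complex (fst z) (snd z)"
  let ?R = "\<lambda>z::real \<times> real. (Re w * fst z - Im w * snd z, Im w * fst z + Re w * snd z)"
  have C[measurable]: "?C \<in> borel \<rightarrow>\<^sub>M borel"
    by (intro borel_measurable_continuous_onI continuous_intros)
  have R[measurable]: "?R \<in> borel \<rightarrow>\<^sub>M borel"
    by (intro borel_measurable_continuous_onI continuous_intros)
  have w: "(Re w)\<^sup>2 + (Im w)\<^sup>2 = 1"
    using assms(1) by (simp add: cmod_def)
  moreover have "Re w \<noteq> -1"
    using w assms(2) by (auto simp: complex_eq_iff)
  ultimately have rot: "distr lborel borel ?R = lborel"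
    by (rule lborel_rotation)
  have "distr lborel borel (\<lambda>z. w * z) = distr (distr lborel borel ?C) borel (\<lambda>z. w * z)"
    by (simp only: lborel_complex)
  also have "\<dots> = distr lborel borel ((\<lambda>z. w * z) \<circ> ?C)"
    by (subst distr_distr) auto
  also have "(\<lambda>z. w * z) \<circ> ?C = ?C \<circ> ?R"
    by (auto simp: fun_eq_iff complex_eq_iff algebra_simps)
  also have "distr lborel borel (?C \<circ> ?R) = distr (distr lborel borel ?R) borel ?C"
    by (subst distr_distr) auto
  also have "\<dots> = lborel"
    by (simp only: rot lborel_complex)
  finally show ?thesis .
qed

text \<open>Simultaneous rotation of both coordinates is what right translation by the torus becomes
  under \<open>su2_of\<close>; the measure is a product, so each factor is treated
  separately.\<close>

lemma lborel_cmult_prod: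
  fixes w :: complex
  assumes "cmod w = 1" "w \<noteq> -1"
  shows "distr lborel borel (\<lambda>z::complex \<times> complex. (w * fst z, w * snd z)) = lborel"
proof -
  have "distr lborel borel (\<lambda>z::complex. w * z) \<Otimes>\<^sub>M distr lborel borel (\<lambda>z::complex. w * z) =
      distr (lborel \<Otimes>\<^sub>M lborel) (borel \<Otimes>\<^sub>M borel) (\<lambda>(x, y). (w * x, w * y))"
    by (rule pair_measure_distr) (auto simp: lborel_cmult[OF assms] sigma_finite_lborel)
  then have "lborel = distr lborel borel (\<lambda>(x, y). (w * x, w * y))"
    by (simp add: lborel_cmult[OF assms] lborel_prod borel_prod)
  then show ?thesis
    unfolding case_prod_beta' by (rule sym)
qed

section \<open>Compactness of SU(2) and convergence of the Haar integral\<close>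

text \<open>The Gaussian is a product of one-dimensional Gaussians over the basis, so its integral
  is a finite product of finite integrals.\<close>

lemma integrable_gaussian:
  "integrable lborel (\<lambda>z::'a::euclidean_space. exp (- (norm z)\<^sup>2))"
proof (rule integrableI_bounded)
  have g: "integrable lborel (\<lambda>x::real. exp (- x\<^sup>2))"
    using has_bochner_integral_even_function[OF gaussian_moment_0]
    by (auto simp: has_bochner_integral_iff)
  have "(norm z)\<^sup>2 = (\<Sum>b\<in>Basis. (z \<bullet> b)\<^sup>2)" for z :: 'a
    unfolding power2_norm_eq_inner by (subst euclidean_inner) (simp add: power2_eq_square)
  then have "exp (- (norm z)\<^sup>2) = (\<Prod>b\<in>Basis. exp (- (z \<bullet> b)\<^sup>2))" for z :: 'a
    by (simp add: exp_sum sum_negf[symmetric])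
  then have "(\<integral>\<^sup>+z. norm (exp (- (norm z)\<^sup>2)) \<partial>(lborel :: 'a measure)) =
      (\<integral>\<^sup>+z. (\<Prod>b\<in>Basis. ennreal (exp (- (z \<bullet> b)\<^sup>2))) \<partial>(lborel :: 'a measure))"
    by (simp add: prod_ennreal abs_prod)
  also have "\<dots> = (\<Prod>b\<in>(Basis::'a set). (\<integral>\<^sup>+x. exp (- x\<^sup>2) \<partial>lborel))"
    by (subst nn_integral_lborel_prod) auto
  also have "\<dots> < \<infinity>"
    using g by (subst nn_integral_eq_integral) (auto simp: ennreal_power[symmetric] power_less_top_ennreal)
  finally show "(\<integral>\<^sup>+z. norm (exp (- (norm z)\<^sup>2)) \<partial>(lborel :: 'a measure)) < \<infinity>" .
qed simp

lemma SU2_eq_image_sphere: "SU2 = su2_of ` sphere 0 1"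
proof
  show "su2_of ` sphere 0 1 \<subseteq> SU2"
    using su2_of_in_SU2 by auto
  show "SU2 \<subseteq> su2_of ` sphere 0 1"
  proof
    fix U assume "U \<in> SU2"
    define a b c d where "a = U$1$1" "b = U$1$2" "c = U$2$1" "d = U$2$2"
    have 1: "a * cnj a + c * cnj c = 1" "cnj a * b + cnj c * d = 0" "a * d - b * c = 1"
      using \<open>U \<in> SU2\<close> unfolding SU2_def a_b_c_d_def
      by (auto simp: cmat_eq_iff adj_def matrix_matrix_mult_def sum_2 det_2 mat_def mult.commute)
    \<comment> \<open>Multiply \<open>d\<close> and \<open>b\<close> by the first relation, written
      as \<open>1\<close>, and eliminate \<open>cnj a * b\<close> and the products
      \<open>a * d\<close>, \<open>b * c\<close> with the other two.\<close>
    have "d = cnj a" "b = - cnj c"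
      using 1 by algebra+
    then have "U = su2_of (a, c)"
      by (simp add: cmat_eq_iff su2_of_def a_b_c_d_def)
    moreover have "complex_of_real ((cmod a)\<^sup>2 + (cmod c)\<^sup>2) = 1"
      using 1(1) unfolding of_real_add complex_norm_square .
    then have "norm (a, c) = 1"
      by (simp add: norm_prod_def del: of_real_add of_real_power)
    ultimately show "U \<in> su2_of ` sphere 0 1" by auto
  qed
qed

lemma continuous_on_su2_of: "continuous_on S su2_of"
proof -
  have "continuous_on S (\<lambda>z. su2_of z $ i $ j)" for i j
    using exhaust_2[of i] exhaust_2[of j] by (auto simp: su2_of_def intro!: continuous_intros)
  then have "continuous_on S (\<lambda>z. \<chi> i j. su2_of z $ i $ j)"
    by (intro continuous_on_vec_lambda)
  then show ?thesis by simp
qed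

lemma compact_SU2: "compact SU2"
  unfolding SU2_eq_image_sphere by (intro compact_continuous_image continuous_on_su2_of compact_sphere)

lemma SU2_bounded:
  fixes f :: "cmat \<Rightarrow> complex"
  assumes "continuous_on SU2 f"
  obtains B where "B \<ge> 0" "\<And>x. x \<in> SU2 \<Longrightarrow> cmod (f x) \<le> B"
proof -
  have "bounded (f ` SU2)"
    using compact_continuous_image[OF assms compact_SU2] by (rule compact_imp_bounded)
  then obtain B where "\<And>x. x \<in> SU2 \<Longrightarrow> cmod (f x) \<le> B"
    unfolding bounded_iff by auto
  then show thesis
    using that[of "max B 0"] by (metis max.cobounded2 max.coboundedI1)
qed

text \<open>At \<open>z = 0\<close> the convention \<open>1 / 0 = 0\<close> gives the zero matrix,
  which is not in the group. The arguments below set this point aside as a null set.\<close>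

abbreviation su2_dir :: "complex \<times> complex \<Rightarrow> cmat" where
  "su2_dir z \<equiv> su2_of ((1 / norm z) *\<^sub>R z)"

lemma su2_dir_in_SU2: "z \<noteq> 0 \<Longrightarrow> su2_dir z \<in> SU2"
  by (rule su2_of_in_SU2) simp

lemma measurable_su2_dir:
  assumes "continuous_on SU2 f"
  shows "(\<lambda>z. f (su2_dir z)) \<in> borel_measurable borel"
proof -
  have "continuous_on (- {0}) (\<lambda>z. f (su2_dir z))"
    by (rule continuous_on_compose2[OF assms], rule continuous_on_compose2[OF continuous_on_su2_of])
       (auto intro!: continuous_intros su2_dir_in_SU2)
  then have "(\<lambda>z. if z \<in> {0} then f (su2_dir 0) else f (su2_dir z)) \<in> borel_measurable borel"
    by (intro borel_measurable_continuous_on_if) auto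
  also have "(\<lambda>z. if z \<in> {0} then f (su2_dir 0) else f (su2_dir z)) = (\<lambda>z. f (su2_dir z))"
    by (rule ext) (metis singletonD)
  finally show ?thesis .
qed

lemma integrable_haar:
  assumes "continuous_on SU2 f"
  shows "integrable lborel (\<lambda>z. f (su2_dir z) * complex_of_real (exp (- (norm z)\<^sup>2)))"
proof -
  obtain B where B: "\<And>x. x \<in> SU2 \<Longrightarrow> cmod (f x) \<le> B"
    using SU2_bounded[OF assms] by blast
  show ?thesis
  proof (rule Bochner_Integration.integrable_bound)
    show "integrable lborel (\<lambda>z::complex \<times> complex. B * exp (- (norm z)\<^sup>2))"
      by (intro integrable_mult_right integrable_gaussian)
    show "(\<lambda>z. f (su2_dir z) * complex_of_real (exp (- (norm z)\<^sup>2))) \<in> borel_measurable lborel"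
      using measurable_su2_dir[OF assms] by measurable
    show "AE z in lborel. norm (f (su2_dir z) * complex_of_real (exp (- (norm z)\<^sup>2)))
        \<le> norm (B * exp (- (norm z)\<^sup>2))"
      using AE_lborel_singleton[of "0 :: complex \<times> complex"]
    proof eventually_elim
      case (elim z)
      then have "cmod (f (su2_dir z)) \<le> \<bar>B\<bar>"
        using B[OF su2_dir_in_SU2] by fastforce
      then show ?case by (simp add: norm_mult abs_mult)
    qed
  qed
qed

lemma haar_int_cong:
  assumes "continuous_on SU2 g" "\<And>x. x \<in> SU2 \<Longrightarrow> f x = g x"
  shows "haar_int f = haar_int g"
  unfolding haar_int_def
proof (rule integral_cong_AE)
  have f: "continuous_on SU2 f"
    using assms continuous_on_cong by metis
  show "(\<lambda>z. f (su2_dir z) * complex_of_real (exp (- (norm z)\<^sup>2))) \<in> borel_measurable lborel"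
    "(\<lambda>z. g (su2_dir z) * complex_of_real (exp (- (norm z)\<^sup>2))) \<in> borel_measurable lborel"
    using integrable_haar[OF f] integrable_haar[OF assms(1)] by auto
  show "AE z in lborel. f (su2_dir z) * complex_of_real (exp (- (norm z)\<^sup>2)) =
      g (su2_dir z) * complex_of_real (exp (- (norm z)\<^sup>2))"
    using AE_lborel_singleton[of "0 :: complex \<times> complex"]
    by eventually_elim (use assms(2) su2_dir_in_SU2 in auto)
qed

lemma haar_int_add:
  assumes "continuous_on SU2 f" "continuous_on SU2 g"
  shows "haar_int (\<lambda>x. f x + g x) = haar_int f + haar_int g"
  unfolding haar_int_def
  by (simp add: integrable_haar[OF assms(1)] integrable_haar[OF assms(2)] distrib_right)

lemma haar_int_cmult: "haar_int (\<lambda>x. c * f x) = c * haar_int f"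
  unfolding haar_int_def by (simp add: mult.assoc)

lemma haar_int_diff:
  assumes "continuous_on SU2 f" "continuous_on SU2 g"
  shows "haar_int (\<lambda>x. f x - g x) = haar_int f - haar_int g"
  unfolding haar_int_def
  by (simp add: integrable_haar[OF assms(1)] integrable_haar[OF assms(2)] left_diff_distrib)

lemma haar_int_cnj: "haar_int (\<lambda>x. cnj (f x)) = cnj (haar_int f)"
  unfolding haar_int_def by (subst Bochner_Integration.integral_cnj[symmetric]) simp

section \<open>Invariance of the Haar integral and integration by parts\<close>

lemma su2_of_mult_expZ:
  "su2_of z ** expZ 3 t = su2_of (cis (t/2) * fst z, cis (t/2) * snd z)"
  by (simp add: su2_of_def expZ_entries cmat_eq_iff matrix_matrix_mult_def sum_2 cis_cnj)

text \<open>In the coordinates \<open>z\<close> the translation multiplies both components by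
  \<open>cis (t/2)\<close>, which preserves Lebesgue measure and the Gaussian weight. The excluded
  value is the half turn of the shear decomposition; the small \<open>t\<close> used in difference
  quotients avoid it.\<close>

lemma haar_int_mult_expZ:
  assumes "continuous_on SU2 f" "cis (t/2) \<noteq> -1"
  shows "haar_int (\<lambda>x. f (x ** expZ 3 t)) = haar_int f"
proof -
  define w where "w = cis (t/2)"
  let ?R = "\<lambda>z::complex \<times> complex. (w * fst z, w * snd z)"
  let ?F = "\<lambda>z. f (su2_dir z) * complex_of_real (exp (- (norm z)\<^sup>2))"
  have R[measurable]: "?R \<in> borel \<rightarrow>\<^sub>M borel"
    by (intro borel_measurable_continuous_onI continuous_intros)
  have n: "norm (?R z) = norm z" for z
    by (simp add: norm_prod_def norm_mult w_def)
  have "su2_dir (?R z) = su2_dir z ** expZ 3 t" for z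
    unfolding su2_of_mult_expZ n w_def[symmetric] by simp
  then have "?F (?R z) = f (su2_dir z ** expZ 3 t) * complex_of_real (exp (- (norm z)\<^sup>2))" for z
    by (simp only: n)
  moreover have "haar_int f = integral\<^sup>L (distr lborel borel ?R) ?F"
    unfolding haar_int_def using assms(2)
    by (subst lborel_cmult_prod) (auto simp: w_def)
  moreover have "integral\<^sup>L (distr lborel borel ?R) ?F = (LINT z|lborel. ?F (?R z))"
    using integrable_haar[OF assms(1)] by (intro integral_distr) auto
  ultimately show ?thesis
    by (simp add: haar_int_def)
qed

text \<open>By invariance every small difference quotient along the flow has integral 0. The
  quotients converge pointwise to \<open>partial0 f\<close> and are bounded by its maximum, so
  dominated convergence applies.\<close>

lemma haar_int_partial0:
  assumes f: "smooth_su2 f"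
  shows "haar_int (partial0 f) = 0"
proof -
  define e where "e n = 1 / (real n + 1)" for n
  define q where "q n x = (f (x ** expZ 3 (e n)) - f x) / e n" for n x
  have e: "e n > 0" "e n \<le> 1" for n
    by (auto simp: e_def)
  have cf: "continuous_on SU2 f"
    by (rule smooth_su2_imp_continuous_on[OF f])
  have cft: "continuous_on SU2 (\<lambda>x. f (x ** expZ 3 t))" for t
    by (rule continuous_on_compose2[OF cf bounded_linear.continuous_on[OF bounded_linear_mult_right]])
       (auto intro: SU2_mult_expZ continuous_on_id)
  have cq: "continuous_on SU2 (q n)" for n
    unfolding q_def using e[of n] by (intro continuous_intros cf cft) auto
  have cp: "continuous_on SU2 (partial0 f)"
    by (intro smooth_su2_imp_continuous_on smooth_su2_partial0 f)
  obtain B where B: "B \<ge> 0" "\<And>x. x \<in> SU2 \<Longrightarrow> cmod (partial0 f x) \<le> B"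
    using SU2_bounded[OF cp] by blast
  have q0: "haar_int (q n) = 0" for n
  proof -
    have "e n / 2 < pi" "0 < e n / 2" using e[of n] pi_gt3 by auto
    then have "sin (e n / 2) > 0" by (intro sin_gt_zero) auto
    then have "cis (e n / 2) \<noteq> -1"
      by (auto simp: complex_eq_iff)
    then have "haar_int (\<lambda>x. f (x ** expZ 3 (e n)) - f x) = 0"
      by (simp add: haar_int_diff cf cft haar_int_mult_expZ)
    then show ?thesis
      unfolding q_def using haar_int_cmult[of "1 / e n" "\<lambda>x. f (x ** expZ 3 (e n)) - f x"] by simp
  qed
  have bound: "cmod (q n x) \<le> B" if x: "x \<in> SU2" for n x
  proof -
    \<comment> \<open>Mean value inequality along the flow line; the bound \<open>B\<close> is
      uniform in \<open>n\<close> and \<open>x\<close>.\<close>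
    have "norm (f (x ** expZ 3 (e n)) - f (x ** expZ 3 0)) \<le> B * norm (e n - 0)"
    proof (rule differentiable_bound[where S = "{0..e n}"])
      fix t assume "t \<in> {0..e n}"
      show "((\<lambda>t. f (x ** expZ 3 t)) has_derivative (\<lambda>h. h *\<^sub>R partial0 f (x ** expZ 3 t)))
          (at t within {0..e n})"
        using has_vector_derivative_partial0[OF f x, of t]
        by (auto simp: has_vector_derivative_def intro: has_derivative_at_withinI)
      show "onorm (\<lambda>h. h *\<^sub>R partial0 f (x ** expZ 3 t)) \<le> B"
        using B(2)[OF SU2_mult_expZ[OF x, of 3 t]]
        by (intro onorm_le) (simp add: mult.commute[of B] mult_left_mono)
    qed (use e[of n] in auto)
    then show ?thesis
      using e[of n] by (simp add: q_def expZ_0 norm_divide divide_simps mult.commute)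
  qed
  have lim: "(\<lambda>n. q n x) \<longlonglongrightarrow> partial0 f x" if x: "x \<in> SU2" for x
  proof -
    have "((\<lambda>h. (f (x ** expZ 3 h) - f x) /\<^sub>R h) \<longlongrightarrow> partial0 f x) (at 0)"
    proof -
      have "((\<lambda>h. norm (f (x ** expZ 3 h) - f x - h *\<^sub>R partial0 f x) / norm h) \<longlongrightarrow> 0) (at 0)"
        using has_vector_derivative_partial0_at_0[OF f x]
        unfolding has_vector_derivative_def has_derivative_at by (simp add: expZ_0)
      moreover have "\<forall>\<^sub>F h in at 0. norm (f (x ** expZ 3 h) - f x - h *\<^sub>R partial0 f x) / norm h =
          norm ((f (x ** expZ 3 h) - f x) /\<^sub>R h - partial0 f x)"
        unfolding eventually_at_filter
      proof (intro always_eventually allI impI)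
        fix h :: real assume "h \<noteq> 0"
        then have "(f (x ** expZ 3 h) - f x) /\<^sub>R h - partial0 f x =
            (f (x ** expZ 3 h) - f x - h *\<^sub>R partial0 f x) /\<^sub>R h"
          by (simp add: scaleR_diff_right)
        then show "norm (f (x ** expZ 3 h) - f x - h *\<^sub>R partial0 f x) / norm h =
            norm ((f (x ** expZ 3 h) - f x) /\<^sub>R h - partial0 f x)"
          by (simp add: divide_inverse mult.commute)
      qed
      ultimately show ?thesis
        by (subst Lim_null, subst tendsto_norm_zero_iff[symmetric]) (rule Lim_transform_eventually)
    qed
    moreover have "filterlim e (at 0) sequentially"
      unfolding e_def by real_asymp
    ultimately have "(\<lambda>n. (f (x ** expZ 3 (e n)) - f x) /\<^sub>R e n) \<longlonglongrightarrow> partial0 f x"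
      by (rule filterlim_compose)
    then show ?thesis
      by (simp add: q_def scaleR_conv_of_real divide_inverse mult.commute)
  qed
  have "(\<lambda>n. haar_int (q n)) \<longlonglongrightarrow> haar_int (partial0 f)"
    unfolding haar_int_def
  proof (rule integral_dominated_convergence[where
        w="\<lambda>z::complex \<times> complex. B * exp (- (norm z)\<^sup>2)"])
    show "integrable lborel (\<lambda>z::complex \<times> complex. B * exp (- (norm z)\<^sup>2))"
      by (intro integrable_mult_right integrable_gaussian)
    show "AE z in lborel. (\<lambda>n. q n (su2_dir z) * complex_of_real (exp (- (norm z)\<^sup>2)))
        \<longlonglongrightarrow> partial0 f (su2_dir z) * complex_of_real (exp (- (norm z)\<^sup>2))"
      using AE_lborel_singleton[of "0 :: complex \<times> complex"]
      by eventually_elim (auto intro!: tendsto_mult lim su2_dir_in_SU2)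
    show "AE z in lborel. norm (q n (su2_dir z) * complex_of_real (exp (- (norm z)\<^sup>2)))
        \<le> B * exp (- (norm z)\<^sup>2)" for n
      using AE_lborel_singleton[of "0 :: complex \<times> complex"]
      by eventually_elim (auto simp: norm_mult intro!: mult_right_mono bound su2_dir_in_SU2)
  qed (use integrable_haar[OF cq] integrable_haar[OF cp] in auto)
  then show ?thesis
    by (simp add: q0 LIMSEQ_const_iff)
qed

lemma haar_int_partial0_by_parts:
  assumes "smooth_su2 f" "smooth_su2 g"
  shows "haar_int (\<lambda>x. partial0 f x * g x) = - haar_int (\<lambda>x. f x * partial0 g x)"
proof -
  have "haar_int (\<lambda>x. f x * partial0 g x) + haar_int (\<lambda>x. partial0 f x * g x) =
      haar_int (\<lambda>x. f x * partial0 g x + partial0 f x * g x)"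
    using assms by (intro haar_int_add[symmetric] smooth_su2_imp_continuous_on smooth_su2_mult
        smooth_su2_partial0)
  also have "\<dots> = haar_int (partial0 (\<lambda>x. f x * g x))"
    using assms by (intro haar_int_cong[symmetric] partial0_mult smooth_su2_imp_continuous_on
        smooth_su2_partial0 smooth_su2_mult smooth_su2_add)
  also have "\<dots> = 0"
    using assms by (intro haar_int_partial0 smooth_su2_mult)
  finally show ?thesis
    by (simp add: add_eq_0_iff)
qed

section \<open>The torus as a null set for the Haar integral\<close>

text \<open>For nonzero \<open>z\<close>, \<open>su2_dir z\<close> lies on the diagonal torus
  exactly when \<open>snd z = 0\<close>; by Fubini this set is null.\<close>

lemma AE_snd_nonzero: "AE z in lborel. snd (z :: complex \<times> complex) \<noteq> 0"
proof -
  have "AE x in (lborel::complex measure). AE y in (lborel::complex measure). snd (x, y) \<noteq> 0"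
    using AE_lborel_singleton[of "0::complex"] by simp
  then have "AE z in (lborel::complex measure) \<Otimes>\<^sub>M (lborel::complex measure). snd z \<noteq> 0"
  proof (rule lborel_pair.AE_pair_measure[rotated])
    show "{z \<in> space (lborel \<Otimes>\<^sub>M lborel). snd z \<noteq> (0::complex)}
        \<in> sets ((lborel::complex measure) \<Otimes>\<^sub>M (lborel::complex measure))"
      by measurable
  qed
  then show ?thesis by (simp only: lborel_prod)
qed

text \<open>On the group \<open>x$1$1 * x$2$2\<close> is the squared modulus of
  \<open>x$1$1\<close>. It lies in \<open>{0..1}\<close> and is below 1 off the torus, so its powers
  tend to 0 almost everywhere, under a fixed integrable bound.\<close>

lemma haar_int_torus_power_tendsto_0:
  assumes "continuous_on SU2 f"
  shows "(\<lambda>n. haar_int (\<lambda>x. f x * (x$1$1 * x$2$2) ^ n)) \<longlonglongrightarrow> 0"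
proof -
  obtain B where B: "B \<ge> 0" "\<And>x. x \<in> SU2 \<Longrightarrow> cmod (f x) \<le> B"
    using SU2_bounded[OF assms] by blast
  define r where "r z = (cmod (fst z))\<^sup>2 / (norm z)\<^sup>2" for z :: "complex \<times> complex"
  have r: "su2_dir z $ 1 $ 1 * su2_dir z $ 2 $ 2 = complex_of_real (r z)" for z
  proof -
    have "su2_dir z $ 1 $ 1 * su2_dir z $ 2 $ 2 =
        complex_of_real ((1 / norm z)\<^sup>2) * (fst z * cnj (fst z))"
      by (simp add: su2_of_def scaleR_conv_of_real power2_eq_square)
    then show ?thesis
      by (simp add: r_def complex_norm_square[symmetric] power_divide)
  qed
  have r01: "0 \<le> r z" "r z \<le> 1" and r1: "snd z \<noteq> 0 \<Longrightarrow> r z < 1" for z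
  proof -
    have n: "(norm z)\<^sup>2 = (cmod (fst z))\<^sup>2 + (cmod (snd z))\<^sup>2"
      by (simp add: norm_prod_def)
    show "0 \<le> r z" by (simp add: r_def)
    show "r z \<le> 1"
      unfolding r_def n divide_le_eq_1
      using zero_le_power2[of "cmod (fst z)"] zero_le_power2[of "cmod (snd z)"] by argo
    assume "snd z \<noteq> 0"
    then have "(cmod (fst z))\<^sup>2 + (cmod (snd z))\<^sup>2 > 0"
      by (simp add: add_nonneg_pos)
    with \<open>snd z \<noteq> 0\<close> show "r z < 1" unfolding r_def n by simp
  qed
  have "(\<lambda>n. haar_int (\<lambda>x. f x * (x$1$1 * x$2$2) ^ n)) \<longlonglongrightarrow>
      (LINT z|(lborel :: (complex \<times> complex) measure). 0)"
    unfolding haar_int_def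
  proof (rule integral_dominated_convergence[where
        w="\<lambda>z::complex \<times> complex. B * exp (- (norm z)\<^sup>2)"])
    show "integrable lborel (\<lambda>z::complex \<times> complex. B * exp (- (norm z)\<^sup>2))"
      by (intro integrable_mult_right integrable_gaussian)
    have "continuous_on SU2 (\<lambda>x. f x * (x$1$1 * x$2$2) ^ n)" for n
      by (intro continuous_intros assms)
    then show "(\<lambda>z. f (su2_dir z) * (su2_dir z $ 1 $ 1 * su2_dir z $ 2 $ 2) ^ n *
        complex_of_real (exp (- (norm z)\<^sup>2))) \<in> borel_measurable lborel" for n
      using integrable_haar by (auto dest!: borel_measurable_integrable)
    show "AE z in lborel. (\<lambda>n. f (su2_dir z) * (su2_dir z $ 1 $ 1 * su2_dir z $ 2 $ 2) ^ n *
        complex_of_real (exp (- (norm z)\<^sup>2))) \<longlonglongrightarrow> 0"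
      using AE_snd_nonzero
    proof eventually_elim
      case (elim z)
      have "(\<lambda>n. complex_of_real (r z) ^ n) \<longlonglongrightarrow> 0"
        using r01[of z] r1[OF elim] by (intro LIMSEQ_power_zero) simp
      from tendsto_mult_right_zero[OF this, of "f (su2_dir z)"]
      show ?case unfolding r by (rule tendsto_mult_left_zero)
    qed
    show "AE z in lborel. norm (f (su2_dir z) * (su2_dir z $ 1 $ 1 * su2_dir z $ 2 $ 2) ^ n *
        complex_of_real (exp (- (norm z)\<^sup>2))) \<le> B * exp (- (norm z)\<^sup>2)" for n
      using AE_lborel_singleton[of "0 :: complex \<times> complex"]
    proof eventually_elim
      case (elim z)
      have "cmod (f (su2_dir z)) * r z ^ n \<le> B * 1"
        using r01 B su2_dir_in_SU2[OF elim] by (intro mult_mono power_le_one) auto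
      then show ?case
        unfolding r using r01 by (simp add: norm_mult norm_power)
    qed
  qed auto
  then show ?thesis by simp
qed

section \<open>The operator\<close>

lemma is_dist_linear:
  assumes "is_dist u" "smooth_su2 f" "smooth_su2 g"
  shows "u (\<lambda>x. a * f x + b * g x) = a * u f + b * u g"
  using assms unfolding is_dist_def by blast

text \<open>The difference vanishes on the group, hence has seminorm 0, and the continuity estimate
  forces the distribution to vanish on it.\<close>

lemma is_dist_cong:
  assumes u: "is_dist u" and f: "smooth_su2 f" and eq: "\<And>x. x \<in> SU2 \<Longrightarrow> g x = f x"
  shows "u g = u f"
proof -
  have g: "smooth_su2 g"
    using smooth_su2_cong[OF f eq] .
  obtain C k where C: "\<And>h. smooth_su2 h \<Longrightarrow> cmod (u h) \<le> C * seminorm_k k h"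
    using u unfolding is_dist_def by blast
  have "smooth_su2 (\<lambda>x. 1 * g x + (-1) * f x)"
    by (intro smooth_su2_intros f g)
  from C[OF this] have "u (\<lambda>x. 1 * g x + (-1) * f x) = 0"
    using eq by (simp add: seminorm_k_eq_0)
  then show ?thesis
    using is_dist_linear[OF u g f, of 1 "-1"] by simp
qed

text \<open>The product \<open>(D + a) (D + b)\<close> multiplied out. The result is symmetric in
  \<open>a\<close> and \<open>b\<close>, which later allows the factors to be swapped.\<close>

lemma partial0_shift:
  assumes "smooth_su2 f" "smooth_su2 g" "\<And>x. x \<in> SU2 \<Longrightarrow> g x = partial0 f x + b * f x"
    "x \<in> SU2"
  shows "partial0 g x + a * g x =
    partial0 (partial0 f) x + (a + b) * partial0 f x + a * b * f x"
proof -
  have "partial0 g x = partial0 (\<lambda>x. partial0 f x + b * f x) x"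
    using assms by (intro lider_cong)
  also have "\<dots> = partial0 (partial0 f) x + b * partial0 f x"
    using assms by (simp add: partial0_add partial0_cmult smooth_su2_intros smooth_su2_partial0)
  finally show ?thesis
    using assms(3)[OF assms(4)] by (simp add: algebra_simps)
qed

text \<open>For the bilinear Haar pairing the transpose of \<open>D - c\<close> is
  \<open>- (D + c)\<close>.\<close>

lemma haar_int_shift:
  assumes f: "smooth_su2 f" and g: "smooth_su2 g"
  shows "haar_int (\<lambda>x. (partial0 f x - c * f x) * g x) =
    - haar_int (\<lambda>x. f x * (partial0 g x + c * g x))"
proof -
  note smooth = smooth_su2_intros smooth_su2_partial0 f g smooth_su2_imp_continuous_on
  have "haar_int (\<lambda>x. (partial0 f x - c * f x) * g x) =
      haar_int (\<lambda>x. partial0 f x * g x - c * (f x * g x))"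
    by (simp add: algebra_simps)
  also have "\<dots> = haar_int (\<lambda>x. partial0 f x * g x) - c * haar_int (\<lambda>x. f x * g x)"
    by (subst haar_int_diff) (auto simp: haar_int_cmult intro!: smooth)
  also have "\<dots> = - (haar_int (\<lambda>x. f x * partial0 g x) + c * haar_int (\<lambda>x. f x * g x))"
    by (simp add: haar_int_partial0_by_parts[OF f g])
  also have "haar_int (\<lambda>x. f x * partial0 g x) + c * haar_int (\<lambda>x. f x * g x) =
      haar_int (\<lambda>x. f x * partial0 g x + c * (f x * g x))"
    by (subst haar_int_add) (auto simp: haar_int_cmult intro!: smooth)
  also have "\<dots> = haar_int (\<lambda>x. f x * (partial0 g x + c * g x))"
    by (simp add: algebra_simps)
  finally show ?thesis .
qed

text \<open>The equation is tested against \<open>g\<close>, against \<open>partial0 g\<close>, and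
  against \<open>cnj g\<close> followed by conjugation. The three identities involve the conjugate
  distribution only through two numbers, which a linear combination removes.\<close>

lemma Pop_eliminate_conjugate:
  fixes p q :: complex
  assumes u: "is_dist u" and f: "smooth_su2 f" and g: "smooth_su2 g"
    and P: "\<And>\<phi>. smooth_su2 \<phi> \<Longrightarrow> Pop p q u \<phi> = haar_int (\<lambda>x. f x * \<phi> x)"
  shows "u (partial0 (partial0 g)) + complex_of_real (2 * Re q) * u (partial0 g)
      + complex_of_real ((cmod q)\<^sup>2 - (cmod p)\<^sup>2) * u g =
    haar_int (\<lambda>x. (p * cnj (f x) - cnj q * f x + partial0 f x) * g x)"
proof -
  note smooth = smooth_su2_intros smooth_su2_partial0 f g smooth_su2_imp_continuous_on
  \<comment> \<open>The values of \<open>dconj u\<close> at \<open>g\<close> and at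
    \<open>partial0 g\<close>, the two unknowns to be eliminated.\<close>
  define V V1 where "V = cnj (u (\<lambda>x. cnj (g x)))" "V1 = cnj (u (\<lambda>x. cnj (partial0 g x)))"
  define h0 h1 h2 where "h0 = haar_int (\<lambda>x. f x * g x)"
    "h1 = haar_int (\<lambda>x. f x * partial0 g x)" "h2 = haar_int (\<lambda>x. cnj (f x) * g x)"
  have 0: "- u (partial0 g) - q * u g - p * V = h0"
    using P[OF g] by (simp add: Pop_def dpartial0_def dconj_def V_V1_def h0_h1_h2_def)
  have 1: "- u (partial0 (partial0 g)) - q * u (partial0 g) - p * V1 = h1"
    using P[OF smooth_su2_partial0[OF g]]
    by (simp add: Pop_def dpartial0_def dconj_def V_V1_def h0_h1_h2_def)
  have "u (partial0 (\<lambda>x. cnj (g x))) = cnj V1"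
    unfolding V_V1_def complex_cnj_cnj
    by (rule is_dist_cong[OF u]) (auto intro!: smooth simp: partial0_cnj[OF g])
  then have "- cnj V1 - q * cnj V - p * cnj (u g) = haar_int (\<lambda>x. f x * cnj (g x))"
    using P[OF smooth_su2_cnj[OF g]] by (simp add: Pop_def dpartial0_def dconj_def V_V1_def)
  from arg_cong[OF this, of cnj] have 2: "- V1 - cnj q * V - cnj p * u g = h2"
    by (simp add: h0_h1_h2_def haar_int_cnj[symmetric])
  have h1: "h1 = - haar_int (\<lambda>x. partial0 f x * g x)"
    by (simp add: h0_h1_h2_def haar_int_partial0_by_parts f g)
  have "haar_int (\<lambda>x. (p * cnj (f x) - cnj q * f x + partial0 f x) * g x) =
      haar_int (\<lambda>x. (p * (cnj (f x) * g x) - cnj q * (f x * g x)) + partial0 f x * g x)"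
    by (simp add: algebra_simps)
  also have "\<dots> = haar_int (\<lambda>x. p * (cnj (f x) * g x) - cnj q * (f x * g x)) - h1"
    unfolding h1 by (subst haar_int_add) (auto intro!: smooth)
  also have "\<dots> = p * h2 - cnj q * h0 - h1"
    by (subst haar_int_diff) (auto simp: haar_int_cmult h0_h1_h2_def intro!: smooth)
  finally have G: "haar_int (\<lambda>x. (p * cnj (f x) - cnj q * f x + partial0 f x) * g x) =
      p * h2 - cnj q * h0 - h1" .
  have q: "complex_of_real ((cmod q)\<^sup>2) = q * cnj q" "complex_of_real ((cmod p)\<^sup>2) = p * cnj p"
    "complex_of_real (2 * Re q) = q + cnj q"
    by (simp_all only: complex_norm_square complex_add_cnj)
  show ?thesis
    \<comment> \<open>In \<open>p * h2 - cnj q * h0 - h1\<close> all terms with \<open>V\<close> and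
      \<open>V1\<close> cancel.\<close>
    unfolding G of_real_diff q 0[symmetric] 1[symmetric] 2[symmetric]
    by (simp add: algebra_simps)
qed

section \<open>Regularity when both characteristic factors are invertible\<close>

text \<open>A smooth \<open>W\<close> with \<open>(D - z1) (D - z2) W = G\<close> is the candidate
  density. It represents \<open>u\<close> because every test function is
  \<open>(D + z1) (D + z2) g\<close> for some smooth \<open>g\<close>, and moving the factors across
  the pairing reduces \<open>u \<phi>\<close> to the eliminated equation.\<close>

lemma globally_hypoelliptic_Pop:
  fixes z1 z2 :: complex
  assumes "z1 + z2 = complex_of_real (2 * Re q)"
    and "z1 * z2 = complex_of_real ((cmod q)\<^sup>2 - (cmod p)\<^sup>2)"
    and z1: "exp (4 * complex_of_real pi * z1) \<noteq> 1" and z2: "exp (4 * complex_of_real pi * z2) \<noteq> 1"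
  shows "globally_hypoelliptic (Pop p q)"
  unfolding globally_hypoelliptic_def
proof (intro allI impI)
  fix u assume u: "is_dist u" and "smooth_dist (Pop p q u)"
  then obtain f where f: "smooth_su2 f"
    and P: "\<And>\<phi>. smooth_su2 \<phi> \<Longrightarrow> Pop p q u \<phi> = haar_int (\<lambda>x. f x * \<phi> x)"
    unfolding smooth_dist_def by blast
  define G where "G x = p * cnj (f x) - cnj q * f x + partial0 f x" for x
  have G: "smooth_su2 G"
    unfolding G_def by (intro smooth_su2_intros smooth_su2_partial0 f)
  obtain W1 where W1: "smooth_su2 W1" "\<And>x. x \<in> SU2 \<Longrightarrow> partial0 W1 x - z1 * W1 x = G x"
    using partial0_solvable[OF G z1] by blast
  obtain W where W: "smooth_su2 W" "\<And>x. x \<in> SU2 \<Longrightarrow> partial0 W x - z2 * W x = W1 x"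
    using partial0_solvable[OF W1(1) z2] by blast
  have "u \<phi> = haar_int (\<lambda>x. W x * \<phi> x)" if \<phi>: "smooth_su2 \<phi>" for \<phi>
  proof -
    \<comment> \<open>The transposed factors \<open>D + z1\<close> and \<open>D + z2\<close> are
      solvable under the same conditions, since the exponentials are only inverted.\<close>
    have neg: "exp (4 * complex_of_real pi * - z1) \<noteq> 1" "exp (4 * complex_of_real pi * - z2) \<noteq> 1"
      using z1 z2 by (simp_all add: exp_minus)
    obtain g1 where g1: "smooth_su2 g1" "\<And>x. x \<in> SU2 \<Longrightarrow> \<phi> x = partial0 g1 x + z1 * g1 x"
      using partial0_solvable[OF \<phi> neg(1)] by fastforce
    obtain g where g: "smooth_su2 g" "\<And>x. x \<in> SU2 \<Longrightarrow> g1 x = partial0 g x + z2 * g x"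
      using partial0_solvable[OF g1(1) neg(2)] by fastforce
    note smooth = smooth_su2_intros smooth_su2_partial0 g(1) W(1) W1(1) G \<phi>
    have \<phi>_eq: "\<phi> x = partial0 (partial0 g) x + (z1 + z2) * partial0 g x + z1 * z2 * g x"
      if "x \<in> SU2" for x
      using g1(2)[OF that] partial0_shift[OF g(1) g1(1) g(2) that, of z1] by simp
    \<comment> \<open>The factor \<open>D - z1\<close> is the first to be moved off
      \<open>W1\<close>, so \<open>\<phi>\<close> is also needed as \<open>(D + z2) h\<close> with
      the factors in the other order.\<close>
    define h where "h x = partial0 g x + z1 * g x" for x
    have h: "smooth_su2 h"
      unfolding h_def by (intro smooth)
    have h_eq: "partial0 h x + z2 * h x = \<phi> x" if "x \<in> SU2" for x
      using partial0_shift[OF g(1) h h_def that, of z2] \<phi>_eq[OF that]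
      by (simp add: algebra_simps)
    have "u \<phi> = u (\<lambda>x. 1 * (1 * partial0 (partial0 g) x + (z1 + z2) * partial0 g x)
        + z1 * z2 * g x)"
      by (rule is_dist_cong[OF u]) (auto simp: \<phi>_eq intro!: smooth)
    also have "\<dots> = 1 * u (\<lambda>x. 1 * partial0 (partial0 g) x + (z1 + z2) * partial0 g x)
        + z1 * z2 * u g"
      by (intro is_dist_linear[OF u] smooth)
    also have "u (\<lambda>x. 1 * partial0 (partial0 g) x + (z1 + z2) * partial0 g x) =
        1 * u (partial0 (partial0 g)) + (z1 + z2) * u (partial0 g)"
      by (intro is_dist_linear[OF u] smooth)
    finally have "u \<phi> = haar_int (\<lambda>x. G x * g x)"
      using Pop_eliminate_conjugate[OF u f g(1) P] assms(1,2) by (simp add: G_def)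
    also have "\<dots> = haar_int (\<lambda>x. (partial0 W1 x - z1 * W1 x) * g x)"
      by (rule haar_int_cong) (auto simp: W1(2) intro!: smooth smooth_su2_imp_continuous_on)
    also have "\<dots> = - haar_int (\<lambda>x. W1 x * h x)"
      unfolding h_def by (rule haar_int_shift[OF W1(1) g(1)])
    also have "haar_int (\<lambda>x. W1 x * h x) = haar_int (\<lambda>x. (partial0 W x - z2 * W x) * h x)"
      by (rule haar_int_cong) (auto simp: W(2) intro!: smooth h smooth_su2_imp_continuous_on)
    also have "\<dots> = - haar_int (\<lambda>x. W x * (partial0 h x + z2 * h x))"
      by (rule haar_int_shift[OF W(1) h])
    also have "haar_int (\<lambda>x. W x * (partial0 h x + z2 * h x)) = haar_int (\<lambda>x. W x * \<phi> x)"
      by (rule haar_int_cong) (auto simp: h_eq intro!: smooth smooth_su2_imp_continuous_on)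
    finally show ?thesis by simp
  qed
  then show "smooth_dist u"
    unfolding smooth_dist_def using W(1) by blast
qed

section \<open>Singular distributions carried by the torus\<close>

definition torus_dist :: "(real \<Rightarrow> complex) \<Rightarrow> (cmat \<Rightarrow> complex) \<Rightarrow> complex" where
  "torus_dist w \<phi> = integral {0..4*pi} (\<lambda>t. w t * \<phi> (expZ 3 t))"

lemma continuous_on_expZ:
  assumes "smooth_su2 \<phi>"
  shows "continuous_on S (\<lambda>t. \<phi> (expZ 3 t))"
  using continuous_on_expZ_compose[OF assms mat1_in_SU2, of S] by simp

lemma torus_integrable:
  assumes "continuous_on {0..4*pi} w" "smooth_su2 \<phi>"
  shows "(\<lambda>t. w t * \<phi> (expZ 3 t)) integrable_on {0..4*pi}"
  by (intro integrable_continuous_real continuous_intros assms continuous_on_expZ)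

text \<open>A measure with bounded density is of order zero: the supremum over the group, which is
  \<open>seminorm_k 0\<close>, controls it.\<close>

lemma is_dist_torus_dist:
  assumes w: "continuous_on {0..4*pi} w"
  shows "is_dist (torus_dist w)"
  unfolding is_dist_def
proof (intro conjI allI impI)
  fix \<phi> \<psi> :: "cmat \<Rightarrow> complex" and a b
  assume s: "smooth_su2 \<phi>" "smooth_su2 \<psi>"
  have "torus_dist w (\<lambda>x. a * \<phi> x + b * \<psi> x) =
      integral {0..4*pi} (\<lambda>t. a * (w t * \<phi> (expZ 3 t)) + b * (w t * \<psi> (expZ 3 t)))"
    by (simp add: torus_dist_def algebra_simps)
  also have "\<dots> = a * torus_dist w \<phi> + b * torus_dist w \<psi>"
    unfolding torus_dist_def using torus_integrable[OF w s(1)] torus_integrable[OF w s(2)]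
    by (subst integral_add) (auto intro: integrable_on_mult_right)
  finally show "torus_dist w (\<lambda>x. a * \<phi> x + b * \<psi> x) = a * torus_dist w \<phi> + b * torus_dist w \<psi>" .
next
  obtain B where B: "B \<ge> 0" "\<And>t. t \<in> {0..4*pi} \<Longrightarrow> cmod (w t) \<le> B"
  proof -
    have "bounded (w ` {0..4*pi})"
      by (intro compact_imp_bounded compact_continuous_image w) simp
    then obtain B where "\<And>t. t \<in> {0..4*pi} \<Longrightarrow> cmod (w t) \<le> B"
      unfolding bounded_iff by blast
    moreover from this[of 0] have "B \<ge> 0"
      using norm_ge_zero[of "w 0"] by (simp del: norm_ge_zero)
    ultimately show thesis using that by blast
  qed
  have "cmod (torus_dist w \<phi>) \<le> (B * (4*pi)) * seminorm_k 0 \<phi>" if \<phi>: "smooth_su2 \<phi>" for \<phi>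
  proof -
    have "{v. length v \<le> 0 \<and> set v \<subseteq> {1, 2, 3}} = {[] :: nat list}"
      by auto
    then have sn: "seminorm_k 0 \<phi> = (SUP x\<in>SU2. cmod (\<phi> x))"
      by (simp add: seminorm_k_def)
    obtain M where M: "\<And>x. x \<in> SU2 \<Longrightarrow> cmod (\<phi> x) \<le> M"
      using SU2_bounded[OF smooth_su2_imp_continuous_on[OF \<phi>]] by blast
    have le: "cmod (\<phi> x) \<le> seminorm_k 0 \<phi>" if "x \<in> SU2" for x
      unfolding sn using M by (intro cSUP_upper that bdd_aboveI2[where M=M])
    have "cmod (torus_dist w \<phi>) \<le> (B * seminorm_k 0 \<phi>) * (4*pi - 0)"
      unfolding torus_dist_def
    proof (rule integral_bound)
      show "cmod (w t * \<phi> (expZ 3 t)) \<le> B * seminorm_k 0 \<phi>" if "t \<in> {0..4*pi}" for t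
        unfolding norm_mult using B that by (intro mult_mono le expZ_in_SU2) auto
    qed (auto intro!: continuous_intros w continuous_on_expZ \<phi>)
    then show ?thesis by (simp add: mult_ac)
  qed
  then show "\<exists>C k. \<forall>\<phi>. smooth_su2 \<phi> \<longrightarrow> cmod (torus_dist w \<phi>) \<le> C * seminorm_k k \<phi>"
    by blast
qed

text \<open>Integration by parts over the closed torus moves the derivative onto the density, and
  conjugating the distribution conjugates the density; the differential equation for
  \<open>w\<close> then says that everything cancels.\<close>

lemma Pop_torus_dist:
  assumes w: "\<And>t. (w has_vector_derivative q * w t + p * cnj (w t)) (at t)"
    and per: "w (4*pi) = w 0" and \<phi>: "smooth_su2 \<phi>"
  shows "Pop p q (torus_dist w) \<phi> = 0"
proof -
  have cw: "continuous_on {0..4*pi} w"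
    using w by (auto intro!: continuous_at_imp_continuous_on has_vector_derivative_continuous)
  note int = torus_integrable[OF cw \<phi>] torus_integrable[OF cw smooth_su2_partial0[OF \<phi>]]
    torus_integrable[OF continuous_on_cnj[OF cw] \<phi>]
  have "((\<lambda>t. w t * partial0 \<phi> (expZ 3 t) + (q * w t + p * cnj (w t)) * \<phi> (expZ 3 t))
      has_integral w (4*pi) * \<phi> (expZ 3 (4*pi)) - w 0 * \<phi> (expZ 3 0)) {0..4*pi}"
  proof (rule fundamental_theorem_of_calculus)
    fix t :: real
    have "((\<lambda>t. \<phi> (expZ 3 t)) has_vector_derivative partial0 \<phi> (expZ 3 t)) (at t)"
      using has_vector_derivative_partial0[OF \<phi> mat1_in_SU2, of t] by simp
    from has_vector_derivative_mult[OF w this]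
    show "((\<lambda>t. w t * \<phi> (expZ 3 t)) has_vector_derivative
        w t * partial0 \<phi> (expZ 3 t) + (q * w t + p * cnj (w t)) * \<phi> (expZ 3 t))
        (at t within {0..4*pi})"
      by (rule has_vector_derivative_at_within)
  qed auto
  then have "0 = integral {0..4*pi} (\<lambda>t. w t * partial0 \<phi> (expZ 3 t) +
      (q * (w t * \<phi> (expZ 3 t)) + p * (cnj (w t) * \<phi> (expZ 3 t))))"
    by (simp add: integral_unique expZ_0 expZ_4pi per distrib_right mult.assoc)
  also have "\<dots> = torus_dist w (partial0 \<phi>) + q * torus_dist w \<phi> +
      p * integral {0..4*pi} (\<lambda>t. cnj (w t) * \<phi> (expZ 3 t))"
    unfolding torus_dist_def using int
    by (simp add: integral_add integrable_add integrable_on_mult_right)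
  also have "integral {0..4*pi} (\<lambda>t. cnj (w t) * \<phi> (expZ 3 t)) = dconj (torus_dist w) \<phi>"
    by (simp add: dconj_def torus_dist_def integral_cnj)
  finally show ?thesis
    by (simp add: Pop_def dpartial0_def algebra_simps eq_neg_iff_add_eq_0 neg_eq_iff_add_eq_0)
qed

text \<open>Multiplying by \<open>(x$1$1 * x$2$2) ^ n\<close> leaves a distribution carried by the torus
  unchanged, but concentrates the Haar integral on the torus, a null set.\<close>

lemma not_smooth_dist_torus_dist:
  assumes \<phi>: "smooth_su2 \<phi>" and nz: "torus_dist w \<phi> \<noteq> 0"
  shows "\<not> smooth_dist (torus_dist w)"
proof
  assume "smooth_dist (torus_dist w)"
  then obtain f where f: "smooth_su2 f"
    and eq: "\<And>\<phi>. smooth_su2 \<phi> \<Longrightarrow> torus_dist w \<phi> = haar_int (\<lambda>x. f x * \<phi> x)"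
    unfolding smooth_dist_def by blast
  have "haar_int (\<lambda>x. (f x * \<phi> x) * (x$1$1 * x$2$2) ^ n) = torus_dist w \<phi>" for n
  proof -
    have "torus_dist w \<phi> = torus_dist w (\<lambda>x. \<phi> x * (x$1$1 * x$2$2) ^ n)"
      by (simp add: torus_dist_def expZ_entries cis_mult)
    also have "\<dots> = haar_int (\<lambda>x. f x * (\<phi> x * (x$1$1 * x$2$2) ^ n))"
      by (intro eq smooth_su2_intros \<phi>)
    finally show ?thesis by (simp add: mult.assoc)
  qed
  moreover have "(\<lambda>n. haar_int (\<lambda>x. (f x * \<phi> x) * (x$1$1 * x$2$2) ^ n)) \<longlonglongrightarrow> 0"
    by (intro haar_int_torus_power_tendsto_0 smooth_su2_imp_continuous_on smooth_su2_intros f \<phi>)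
  ultimately show False
    using nz by (simp add: LIMSEQ_const_iff)
qed

lemma not_globally_hypoelliptic_Pop:
  fixes L k :: nat
  defines "m \<equiv> real L / 2 - real k"
  assumes p: "p \<noteq> 0"
    and \<Delta>: "- (complex_of_real m)\<^sup>2 + (complex_of_real (cmod q))\<^sup>2 - (complex_of_real (cmod p))\<^sup>2
          - 2 * \<i> * complex_of_real m * complex_of_real (Re q) = 0"
  shows "\<not> globally_hypoelliptic (Pop p q)"
proof -
  \<comment> \<open>Inserting \<open>A * cis (m * t) + B * cis (- (m * t))\<close> into the
    differential equation gives \<open>(\<i> * m - q) * A = p * cnj B\<close> and
    \<open>- (q + \<i> * m) * B = p * cnj A\<close>. With \<open>A = c * p\<close> the first yields
    \<open>B = cnj c * \<gamma>\<close>, and the second becomes the identity below, the conjugate of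
    the hypothesis on \<open>m\<close>.\<close>
  define \<gamma> where "\<gamma> = cnj (\<i> * m - q)"
  have \<gamma>: "(q + \<i> * m) * \<gamma> = - (p * cnj p)"
  proof -
    have "cnj (- (complex_of_real m)\<^sup>2 + q * cnj q - p * cnj p - \<i> * complex_of_real m * (q + cnj q)) = 0"
      using \<Delta> by (simp add: complex_norm_square[symmetric] complex_add_cnj mult_ac)
    then show ?thesis
      by (simp add: \<gamma>_def algebra_simps power2_eq_square)
  qed
  \<comment> \<open>This is the value at 0 of the solution to be built, so the solution is nonzero
    even when \<open>m = 0\<close> and the two exponentials coincide. If \<open>c = 1\<close> fails
    then \<open>\<gamma> = - p\<close>, and \<open>c = \<i>\<close> gives
    \<open>2 * \<i> * p\<close>.\<close>
  obtain c where c: "c * p + cnj c * \<gamma> \<noteq> 0"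
  proof (cases "p + \<gamma> = 0")
    case True
    then have "\<gamma> = - p" by (simp add: add_eq_0_iff2 add_eq_0_iff)
    then have "\<i> * p + cnj \<i> * \<gamma> \<noteq> 0" using p by simp
    then show thesis by (rule that)
  qed (use that[of 1] in simp)
  define w where "w t = c * p * cis (m * t) + cnj c * \<gamma> * cis (- (m * t))" for t
  have w: "(w has_vector_derivative q * w t + p * cnj (w t)) (at t)" for t
  proof -
    have "((\<lambda>t. cis (r * t)) has_vector_derivative \<i> * r * cis (r * t)) (at t)" for r t :: real
    proof -
      have "((\<lambda>z. exp (\<i> * r * z)) has_field_derivative \<i> * r * exp (\<i> * r * t)) (at (of_real t))"
        by (auto intro!: derivative_eq_intros)
      from has_vector_derivative_real_field[OF this] show ?thesis
        by (simp add: cis_conv_exp mult.assoc)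
    qed
    from has_vector_derivative_add[OF has_vector_derivative_mult_right[OF this, of "c * p" m t]
        has_vector_derivative_mult_right[OF this, of "cnj c * \<gamma>" "- m" t]]
    have "(w has_vector_derivative c * p * (\<i> * m * cis (m * t))
        + cnj c * \<gamma> * (\<i> * (- m) * cis (- (m * t)))) (at t)"
      unfolding w_def by simp
    moreover have "c * p * (\<i> * m * cis (m * t)) + cnj c * \<gamma> * (\<i> * (- m) * cis (- (m * t))) =
        q * w t + p * cnj (w t)"
    proof -
      have "q * w t + p * cnj (w t) = c * p * (q + cnj \<gamma>) * cis (m * t)
          + cnj c * (q * \<gamma> + p * cnj p) * cis (- (m * t))"
        by (simp add: w_def algebra_simps cis_cnj)
      also have "q + cnj \<gamma> = \<i> * m" by (simp add: \<gamma>_def)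
      also have "q * \<gamma> + p * cnj p = - (\<i> * m * \<gamma>)"
        using \<gamma> by algebra
      finally show ?thesis by (simp add: algebra_simps)
    qed
    ultimately show ?thesis by simp
  qed
  have cw: "continuous_on S w" for S
    using w by (auto intro!: continuous_at_imp_continuous_on has_vector_derivative_continuous)
  have per: "w (4*pi) = w 0"
  proof -
    have "m * (4 * pi) = 2 * pi * of_int (int L - 2 * int k)"
      by (simp add: m_def algebra_simps)
    then have "cis (m * (4 * pi)) = 1"
      by (metis cis_multiple_2pi Ints_of_int)
    moreover from this have "cis (- (m * (4 * pi))) = 1"
      by (metis cis_inverse inverse_1)
    ultimately show ?thesis by (simp add: w_def)
  qed
  \<comment> \<open>A polynomial in the diagonal entries that restricts to \<open>cnj w\<close> on
    the torus, where these entries are \<open>cis (t/2)\<close> and \<open>cis (- (t/2))\<close>.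
    Pairing it with the distribution gives the integral of the squared modulus of
    \<open>w\<close>.\<close>
  define \<phi> :: "cmat \<Rightarrow> complex" where
    "\<phi> x = cnj (c * p) * (x$2$2 ^ L * x$1$1 ^ (2 * k))
      + cnj (cnj c * \<gamma>) * (x$1$1 ^ L * x$2$2 ^ (2 * k))" for x
  have \<phi>: "smooth_su2 \<phi>"
    unfolding \<phi>_def by (intro smooth_su2_intros)
  have "\<phi> (expZ 3 t) = cnj (w t)" for t
  proof -
    have "cis (t/2) ^ L * cis (- (t/2)) ^ (2 * k) = cis (m * t)"
      "cis (- (t/2)) ^ L * cis (t/2) ^ (2 * k) = cis (- (m * t))"
    proof -
      have "m * t = real L * (t/2) + real (2 * k) * - (t/2)"
        "- (m * t) = real L * - (t/2) + real (2 * k) * (t/2)"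
        by (simp_all add: m_def algebra_simps)
      then show "cis (t/2) ^ L * cis (- (t/2)) ^ (2 * k) = cis (m * t)"
        "cis (- (t/2)) ^ L * cis (t/2) ^ (2 * k) = cis (- (m * t))"
        by (simp_all only: Complex.DeMoivre cis_mult)
    qed
    then show ?thesis
      by (simp add: \<phi>_def w_def expZ_entries cis_cnj)
  qed
  then have "torus_dist w \<phi> = integral {0..4*pi} (\<lambda>t. of_real ((cmod (w t))\<^sup>2))"
    unfolding torus_dist_def complex_norm_square by simp
  also have "\<dots> = of_real (integral {0..4*pi} (\<lambda>t. (cmod (w t))\<^sup>2))"
    by (rule integral_linear[OF _ bounded_linear_of_real, unfolded o_def])
       (intro integrable_continuous_real continuous_intros cw)
  finally have "torus_dist w \<phi> = of_real (integral {0..4*pi} (\<lambda>t. (cmod (w t))\<^sup>2))" .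
  moreover have "integral {0..4*pi} (\<lambda>t. (cmod (w t))\<^sup>2) \<noteq> 0"
  proof -
    have "integral {0..4*pi} (\<lambda>t. (cmod (w t))\<^sup>2) = 0 \<longleftrightarrow> (\<forall>t\<in>{0..4*pi}. (cmod (w t))\<^sup>2 = 0)"
      by (rule integral_eq_0_iff) (auto intro!: continuous_intros cw)
    moreover have "w 0 \<noteq> 0" using c by (simp add: w_def)
    ultimately show ?thesis by auto
  qed
  ultimately have "torus_dist w \<phi> \<noteq> 0" by simp
  then have "\<not> smooth_dist (torus_dist w)"
    by (rule not_smooth_dist_torus_dist[OF \<phi>])
  moreover have "is_dist (torus_dist w)"
    by (rule is_dist_torus_dist[OF cw])
  moreover have "smooth_dist (Pop p q (torus_dist w))"
    unfolding smooth_dist_def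
    by (rule exI[of _ "\<lambda>x. 0"])
       (auto simp: Pop_torus_dist[OF w per] haar_int_def intro: smooth_su2_const)
  ultimately show ?thesis
    unfolding globally_hypoelliptic_def by blast
qed

theorem theorem5p3:
  fixes p q :: complex
  assumes "p \<noteq> 0"
  shows "globally_hypoelliptic (Pop p q) \<longleftrightarrow>
    (\<forall>(L::nat) (k::nat). k \<le> L \<longrightarrow>
       (let l = real L / 2; m = l - real k in
          - (complex_of_real m)\<^sup>2 + (complex_of_real (cmod q))\<^sup>2 - (complex_of_real (cmod p))\<^sup>2
          - 2 * \<i> * complex_of_real m * complex_of_real (Re q) \<noteq> 0))"
    (is "_ \<longleftrightarrow> ?R")
proof
  assume "globally_hypoelliptic (Pop p q)"
  then show ?R
    unfolding Let_def using not_globally_hypoelliptic_Pop[OF assms] by blast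
next
  assume R: ?R
  \<comment> \<open>A root of the characteristic quadratic with exponential 1 would be
    \<open>\<i> * x\<close> with \<open>x\<close> half an integer, and at such a point the quadratic
    is the excluded expression with \<open>m = x\<close>.\<close>
  have root: "exp (4 * complex_of_real pi * z) \<noteq> 1"
    if z: "z\<^sup>2 - 2 * Re q * z + ((cmod q)\<^sup>2 - (cmod p)\<^sup>2) = 0" for z :: complex
  proof
    assume "exp (4 * complex_of_real pi * z) = 1"
    then obtain n :: int where n: "4 * pi * Re z = 0" "4 * pi * Im z = of_int (2 * n) * pi"
      by (auto simp: exp_eq_1)
    define x where "x = complex_of_real (of_int n / 2)"
    have zn: "z = \<i> * x"
      using n by (simp add: x_def complex_eq_iff field_simps)
    \<comment> \<open>Every half-integer is an admissible \<open>m\<close>, as the extreme weight: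
      \<open>k = 0\<close> for the highest, \<open>k = L\<close> for the lowest.\<close>
    obtain L k :: nat where Lk: "k \<le> L" "real L / 2 - real k = of_int n / 2"
    proof (cases "n \<ge> 0")
      case True
      then show thesis using that[of 0 "nat n"] by simp
    next
      case False
      then show thesis using that[of "nat (- n)" "nat (- n)"] by (simp add: field_simps)
    qed
    have "- x\<^sup>2 + (complex_of_real (cmod q))\<^sup>2 - (complex_of_real (cmod p))\<^sup>2
        - 2 * \<i> * x * complex_of_real (Re q) \<noteq> 0"
      using R Lk unfolding Let_def x_def by metis
    with z show False
      unfolding zn by (simp add: power_mult_distrib algebra_simps)
  qed
  define a b where "a = complex_of_real (Re q)" "b = complex_of_real ((cmod q)\<^sup>2 - (cmod p)\<^sup>2)"
  \<comment> \<open>The roots of \<open>z\<^sup>2 - 2 * a * z + b\<close> are \<open>a + s\<close>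
    and \<open>a - s\<close>.\<close>
  define s where "s = csqrt (a\<^sup>2 - b)"
  have s: "s\<^sup>2 = a\<^sup>2 - b" by (simp add: s_def)
  show "globally_hypoelliptic (Pop p q)"
  proof (rule globally_hypoelliptic_Pop)
    show "(a + s) + (a - s) = complex_of_real (2 * Re q)"
      by (simp add: a_b_def)
    show "(a + s) * (a - s) = complex_of_real ((cmod q)\<^sup>2 - (cmod p)\<^sup>2)"
      using s by (simp add: a_b_def algebra_simps power2_eq_square)
    show "exp (4 * complex_of_real pi * (a + s)) \<noteq> 1" "exp (4 * complex_of_real pi * (a - s)) \<noteq> 1"
      by (rule root, use s in \<open>simp add: a_b_def algebra_simps power2_eq_square\<close>)+
  qed
qed

end
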